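(* Let $\Bbbk$ be a field and let $H$ be the layered graph of height $4$ with layers $V_0=\{*\}$, $V_1=\{p,q\}$, $V_2=\{w_1,w_2,w_3\}$, $V_3=\{x,y\}$, $V_4=\{a\}$ (nine vertices) and exactly the following thirteen directed edges (written tail $\to$ head): $a\to x$, $a\to y$; $x\to w_1$, $x\to w_2$, $y\to w_1$, $y\to w_3$; $w_1\to p$, $w_2\to p$, $w_2\to q$, $w_3\to p$, $w_3\to q$; $p\to *$, $q\to *$. Then the algebra $A(H)$ over $\Bbbk$ is not Koszul.
   Context: A layered graph of height $N$ is a directed graph $\Gamma=(V,E)$ with $V=\coprod_{i=0}^N V_i$, all $V_i\neq\emptyset$, such that, writing $|v|=i$ for $v\in V_i$ and $t(e),h(e)$ for the tail and head of an edge $e$, one has $|t(e)|=|h(e)|+1$ for every $e\in E$. A path is a sequence of edges $(e_1,\dots,e_k)$ with $h(e_i)=t(e_{i+1})$; it starts at $t(e_1)$ and ends at $h(e_k)$. The algebra $A(\Gamma)$ over $\Bbbk$ is the quotient of the free associative algebra $T(E)$ on the set $E$ by the two-sided ideal generated by the following elements: for every two paths $(e_1,\dots,e_k)$ and $(f_1,\dots,f_k)$ with the same starting vertex and the same ending vertex, all coefficients of powers of $t$ in $(t-e_1)(t-e_2)\cdots(t-e_k)-(t-f_1)(t-f_2)\cdots(t-f_k)$, where $t$ is a formal parameter commuting with all edges. $A(\Gamma)$ is graded with every edge in degree $1$. Since $H$ is a uniform layered graph, $A(H)$ is a quadratic algebra (uniform: for any two edges $e,e'$ with a common tail $u$ there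 is a sequence $h(e)=v_0,v_1,\dots,v_k=h(e')$ of vertices, each the head of an edge with tail $u$, such that for each $i\in\{1,\dots,k\}$ some vertex is the head both of an edge with tail $v_{i-1}$ and of an edge with tail $v_i$). A quadratic algebra $A=T(W)/(R)$, with $W=A_1$ and $R\subseteq W\otimes W$, is Koszul if for every $n\geq 2$ the subspaces $W^{\otimes i}\otimes R\otimes W^{\otimes (n-i-2)}$, $0\le i\le n-2$, generate a distributive lattice of subspaces of $W^{\otimes n}$ (under sum and intersection). *)

theory Defs
  imports
    "HOL-Library.Poly_Mapping"
    "HOL-Algebra.QuotRing"
    "HOL-Algebra.Module"
    "Graph_Theory.Arc_Walk"
begin

section \<open>Algebras over a field\<close>

text \<open>
  The ground field is a type \<open>'k\<close> of class \<open>field\<close>. An associative algebra over \<open>'k\<close> is a record of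
  type \<open>('k, 'a) module\<close>: its ring part carries the multiplication, its \<open>smult\<close> field the scalars.
  Words form a monoid under concatenation, so that \<open>'x list \<Rightarrow>\<^sub>0 'k\<close> is the ring of
  noncommutative polynomials in letters from \<open>'x\<close>.
\<close>

instantiation list :: (type) monoid_add
begin

definition zero_list :: "'a list" where "zero_list = []"

definition plus_list :: "'a list \<Rightarrow> 'a list \<Rightarrow> 'a list" where "plus_list = (@)"

instance
  by standard (simp_all add: zero_list_def plus_list_def)

end

definition letter :: "'x \<Rightarrow> 'x list \<Rightarrow>\<^sub>0 'k::field" where
  "letter x = Poly_Mapping.single [x] 1"

definition free_algebra :: "'x set \<Rightarrow> ('k::field, 'x list \<Rightarrow>\<^sub>0 'k) module" where
  "free_algebra X =
    \<lparr>carrier = {p. Poly_Mapping.keys p \<subseteq> lists X}, mult = (*), one = 1, zero = 0, add = (+),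
     smult = (\<lambda>c p. Poly_Mapping.single [] c * p)\<rparr>"

definition free_algebra_deg :: "'x set \<Rightarrow> nat \<Rightarrow> ('x list \<Rightarrow>\<^sub>0 'k::field) set" where
  "free_algebra_deg X n = {p. Poly_Mapping.keys p \<subseteq> {w \<in> lists X. length w = n}}"

text \<open>\<open>Quot\<close> only produces the quotient ring; the scalars are put back here.\<close>

definition quotient_algebra :: "('k, 'a) module \<Rightarrow> 'a set \<Rightarrow> ('k, 'a set) module" where
  "quotient_algebra T J =
    ring.extend (T Quot J) (module.fields (\<lambda>c C. \<Union>x\<in>C. J +>\<^bsub>T\<^esub> (c \<odot>\<^bsub>T\<^esub> x)))"

inductive_set linear_span :: "('k, 'a) module \<Rightarrow> 'a set \<Rightarrow> 'a set"
  for M :: "('k, 'a) module" and S :: "'a set" where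
  zero: "\<zero>\<^bsub>M\<^esub> \<in> linear_span M S"
| add: "x \<in> S \<Longrightarrow> y \<in> linear_span M S \<Longrightarrow> (c \<odot>\<^bsub>M\<^esub> x) \<oplus>\<^bsub>M\<^esub> y \<in> linear_span M S"


section \<open>Tensor algebra of a vector space\<close>

text \<open>
  \<open>W\<close> is a linear subspace of an algebra \<open>A\<close>; only its structure as a vector space enters. The tensor
  algebra is the free algebra on the set \<open>W\<close> modulo linearity of the inclusion of \<open>W\<close>.
\<close>

definition linearity_relations :: "('k::field, 'a) module \<Rightarrow> 'a set \<Rightarrow> ('a list \<Rightarrow>\<^sub>0 'k) set" where
  "linearity_relations A W =
     {letter (v \<oplus>\<^bsub>A\<^esub> w) - (letter v + letter w) | v w. v \<in> W \<and> w \<in> W} \<union>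
     {letter (c \<odot>\<^bsub>A\<^esub> v) - c \<odot>\<^bsub>free_algebra W\<^esub> letter v | c v. v \<in> W}"

definition linearity_ideal :: "('k::field, 'a) module \<Rightarrow> 'a set \<Rightarrow> ('a list \<Rightarrow>\<^sub>0 'k) set" where
  "linearity_ideal A W = genideal (free_algebra W :: ('k, _) module) (linearity_relations A W)"

definition tensor_algebra ::
    "('k::field, 'a) module \<Rightarrow> 'a set \<Rightarrow> ('k, ('a list \<Rightarrow>\<^sub>0 'k) set) module" where
  "tensor_algebra A W = quotient_algebra (free_algebra W) (linearity_ideal A W)"

definition tensor_power ::
    "('k::field, 'a) module \<Rightarrow> 'a set \<Rightarrow> nat \<Rightarrow> ('a list \<Rightarrow>\<^sub>0 'k) set set" where
  "tensor_power A W n =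
    (\<lambda>p. linearity_ideal A W +>\<^bsub>free_algebra W :: ('k, _) module\<^esub> p) ` free_algebra_deg W n"

text \<open>
  The homomorphism from the free algebra on \<open>W\<close> to \<open>A\<close> extending the inclusion, and the
  homomorphism it induces on the tensor algebra.
\<close>

definition free_eval :: "('k::field, 'a) module \<Rightarrow> ('a list \<Rightarrow>\<^sub>0 'k) \<Rightarrow> 'a" where
  "free_eval A p = (\<Oplus>\<^bsub>A\<^esub>ws\<in>Poly_Mapping.keys p.
     Poly_Mapping.lookup p ws \<odot>\<^bsub>A\<^esub> foldr (\<otimes>\<^bsub>A\<^esub>) ws \<one>\<^bsub>A\<^esub>)"

definition tensor_eval :: "('k::field, 'a) module \<Rightarrow> ('a list \<Rightarrow>\<^sub>0 'k) set \<Rightarrow> 'a" where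
  "tensor_eval A C = the_elem (free_eval A ` C)"


section \<open>Koszul algebras\<close>

text \<open>
  \<open>A\<close> is a graded algebra and \<open>W\<close> its component of degree 1. If \<open>A\<close> is quadratic, it is the
  tensor algebra of \<open>W\<close> modulo the ideal generated by the following \<open>R\<close>.
\<close>

definition quadratic_relations ::
    "('k::field, 'a) module \<Rightarrow> 'a set \<Rightarrow> ('a list \<Rightarrow>\<^sub>0 'k) set set" where
  "quadratic_relations A W = {r \<in> tensor_power A W 2. tensor_eval A r = \<zero>\<^bsub>A\<^esub>}"

text \<open>The subspace \<open>W\<^sup>i \<otimes> R \<otimes> W\<^sup>j\<close> of \<open>W\<^sup>i\<^sup>+\<^sup>2\<^sup>+\<^sup>j\<close> (tensor powers).\<close>

definition relation_subspace ::
    "('k::field, 'a) module \<Rightarrow> 'a set \<Rightarrow> nat \<Rightarrow> nat \<Rightarrow> ('a list \<Rightarrow>\<^sub>0 'k) set set" where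
  "relation_subspace A W i j = linear_span (tensor_algebra A W)
     {u \<otimes>\<^bsub>tensor_algebra A W\<^esub> r \<otimes>\<^bsub>tensor_algebra A W\<^esub> v | u r v.
        u \<in> tensor_power A W i \<and> r \<in> quadratic_relations A W \<and> v \<in> tensor_power A W j}"

inductive_set generated_lattice :: "('k, 'a) module \<Rightarrow> 'a set set \<Rightarrow> 'a set set"
  for M :: "('k, 'a) module" and \<S> :: "'a set set" where
  incl: "X \<in> \<S> \<Longrightarrow> X \<in> generated_lattice M \<S>"
| inter: "X \<in> generated_lattice M \<S> \<Longrightarrow> Y \<in> generated_lattice M \<S> \<Longrightarrow>
    X \<inter> Y \<in> generated_lattice M \<S>"
| sum: "X \<in> generated_lattice M \<S> \<Longrightarrow> Y \<in> generated_lattice M \<S> \<Longrightarrow>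
    X <+>\<^bsub>M\<^esub> Y \<in> generated_lattice M \<S>"

definition generates_distributive_lattice :: "('k, 'a) module \<Rightarrow> 'a set set \<Rightarrow> bool" where
  "generates_distributive_lattice M \<S> \<longleftrightarrow>
    (\<forall>X\<in>generated_lattice M \<S>. \<forall>Y\<in>generated_lattice M \<S>. \<forall>Z\<in>generated_lattice M \<S>.
       X \<inter> (Y <+>\<^bsub>M\<^esub> Z) = (X \<inter> Y) <+>\<^bsub>M\<^esub> (X \<inter> Z))"

text \<open>
  Koszulness is a property of quadratic algebras, so this predicate is meant to be applied to a
  quadratic \<open>A\<close>. Being quadratic is deliberately not a conjunct: the negation of \<open>koszul\<close> thus says
  that one of the lattices fails to be distributive.
\<close>

definition koszul :: "('k::field, 'a) module \<Rightarrow> 'a set \<Rightarrow> bool" where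
  "koszul A W \<longleftrightarrow> (\<forall>n\<ge>2. generates_distributive_lattice (tensor_algebra A W)
     {relation_subspace A W i (n - i - 2) | i. i \<le> n - 2})"


section \<open>Layered graphs and their algebras\<close>

text \<open>The layer \<open>V\<^sub>i\<close> consists of the vertices of level \<open>i\<close>.\<close>

locale layered_graph = wf_digraph G for G :: "('v, 'e) pre_digraph" +
  fixes N :: nat and level :: "'v \<Rightarrow> nat"
  assumes level_le: "v \<in> verts G \<Longrightarrow> level v \<le> N"
    and layer_nonempty: "i \<le> N \<Longrightarrow> \<exists>v\<in>verts G. level v = i"
    and level_arc: "e \<in> arcs G \<Longrightarrow> level (tail G e) = level (head G e) + 1"

definition successors :: "('v, 'e) pre_digraph \<Rightarrow> 'v \<Rightarrow> 'v set" where
  "successors G u = {head G e | e. e \<in> arcs G \<and> tail G e = u}"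

definition uniform :: "('v, 'e) pre_digraph \<Rightarrow> bool" where
  "uniform G \<longleftrightarrow> (\<forall>e\<in>arcs G. \<forall>e'\<in>arcs G. tail G e = tail G e' \<longrightarrow>
     (head G e, head G e') \<in>
       {(v, v'). v \<in> successors G (tail G e) \<and> v' \<in> successors G (tail G e) \<and>
                 successors G v \<inter> successors G v' \<noteq> {}}\<^sup>*)"

text \<open>
  The polynomial \<open>(t - e\<^sub>1) \<cdots> (t - e\<^sub>k)\<close>. Polynomials in the central variable \<open>t\<close> over the free
  algebra are finitely supported functions from exponents to coefficients, with \<open>t\<close> being
  \<open>Poly_Mapping.single 1 1\<close> and constants \<open>Poly_Mapping.single 0 c\<close>.
\<close>

definition path_poly :: "'e list \<Rightarrow> nat \<Rightarrow>\<^sub>0 ('e list \<Rightarrow>\<^sub>0 'k::field)" where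
  "path_poly es =
     prod_list (map (\<lambda>e. Poly_Mapping.single 1 1 - Poly_Mapping.single 0 (letter e)) es)"

definition path_relations :: "('v, 'e) pre_digraph \<Rightarrow> ('e list \<Rightarrow>\<^sub>0 'k::field) set" where
  "path_relations G = {Poly_Mapping.lookup (path_poly es - path_poly fs) m | es fs m.
     length es = length fs \<and>
     (\<exists>u v. pre_digraph.awalk G u es v \<and> pre_digraph.awalk G u fs v)}"

definition graph_ideal :: "('v, 'e) pre_digraph \<Rightarrow> ('e list \<Rightarrow>\<^sub>0 'k::field) set" where
  "graph_ideal G = genideal (free_algebra (arcs G) :: ('k, _) module) (path_relations G)"

definition graph_algebra ::
    "('v, 'e) pre_digraph \<Rightarrow> ('k::field, ('e list \<Rightarrow>\<^sub>0 'k) set) module" where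
  "graph_algebra G = quotient_algebra (free_algebra (arcs G)) (graph_ideal G)"

definition graph_algebra_deg ::
    "('v, 'e) pre_digraph \<Rightarrow> nat \<Rightarrow> ('e list \<Rightarrow>\<^sub>0 'k::field) set set" where
  "graph_algebra_deg G n =
    (\<lambda>p. graph_ideal G +>\<^bsub>free_algebra (arcs G) :: ('k, _) module\<^esub> p) ` free_algebra_deg (arcs G) n"


section \<open>The graph \<open>H\<close>\<close>

datatype H_vertex = v_star | v_p | v_q | v_w1 | v_w2 | v_w3 | v_x | v_y | v_a

definition graph_H :: "(H_vertex, H_vertex \<times> H_vertex) pre_digraph" where
  "graph_H =
    \<lparr>verts = {v_star, v_p, v_q, v_w1, v_w2, v_w3, v_x, v_y, v_a},
     arcs = {(v_a, v_x), (v_a, v_y),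
             (v_x, v_w1), (v_x, v_w2), (v_y, v_w1), (v_y, v_w3),
             (v_w1, v_p), (v_w2, v_p), (v_w2, v_q), (v_w3, v_p), (v_w3, v_q),
             (v_p, v_star), (v_q, v_star)},
     tail = fst, head = snd\<rparr>"

fun H_level :: "H_vertex \<Rightarrow> nat" where
  "H_level v_star = 0"
| "H_level v_p = 1"
| "H_level v_q = 1"
| "H_level v_w1 = 2"
| "H_level v_w2 = 2"
| "H_level v_w3 = 2"
| "H_level v_x = 3"
| "H_level v_y = 3"
| "H_level v_a = 4"

lemma layered_graph_H: "layered_graph graph_H 4 H_level"
proof
  show "tail graph_H e \<in> verts graph_H" if "e \<in> arcs graph_H" for e
    using that by (cases e; cases "fst e"; simp add: graph_H_def)
  show "head graph_H e \<in> verts graph_H" if "e \<in> arcs graph_H" for e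
    using that by (cases e; cases "snd e"; simp add: graph_H_def)
  show "H_level v \<le> 4" if "v \<in> verts graph_H" for v
    by (cases v) simp_all
  show "\<exists>v\<in>verts graph_H. H_level v = i" if "i \<le> 4" for i
  proof -
    from that consider "i = 0" | "i = 1" | "i = 2" | "i = 3" | "i = 4" by linarith
    then show ?thesis by cases (simp_all add: graph_H_def)
  qed
  have "\<forall>e\<in>arcs graph_H. H_level (tail graph_H e) = H_level (head graph_H e) + 1"
    by (simp add: graph_H_def)
  then show "H_level (tail graph_H e) = H_level (head graph_H e) + 1" if "e \<in> arcs graph_H" for e
    using that by blast
qed

lemma successors_graph_H: "successors graph_H u = {v. (u, v) \<in> arcs graph_H}"
  by (simp add: successors_def graph_H_def del: insert_iff)

lemma uniform_graph_H: "uniform graph_H"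
proof -
  have common: "v = v' \<or> successors graph_H v \<inter> successors graph_H v' \<noteq> {}"
    if "(u, v) \<in> arcs graph_H" "(u, v') \<in> arcs graph_H" for u v v'
  proof -
    have w: "(v_w1, v_p) \<in> arcs graph_H" "(v_w2, v_p) \<in> arcs graph_H" "(v_w3, v_p) \<in> arcs graph_H"
      "(v_x, v_w1) \<in> arcs graph_H" "(v_y, v_w1) \<in> arcs graph_H"
      "(v_p, v_star) \<in> arcs graph_H" "(v_q, v_star) \<in> arcs graph_H"
      by (simp_all add: graph_H_def)
    have "(v \<in> {v_w1, v_w2, v_w3} \<and> v' \<in> {v_w1, v_w2, v_w3}) \<or> (v \<in> {v_x, v_y} \<and> v' \<in> {v_x, v_y}) \<or>
        (v \<in> {v_p, v_q} \<and> v' \<in> {v_p, v_q}) \<or> v = v'"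
      using that by (cases u) (simp_all add: graph_H_def, blast+)
    then have "(\<exists>z. (v, z) \<in> arcs graph_H \<and> (v', z) \<in> arcs graph_H) \<or> v = v'"
      using w by blast
    then show ?thesis
      unfolding successors_graph_H by blast
  qed
  show ?thesis
    unfolding uniform_def
  proof (intro ballI impI)
    fix e e'
    assume e: "e \<in> arcs graph_H" and e': "e' \<in> arcs graph_H"
      and tails: "tail graph_H e = tail graph_H e'"
    have in_succ: "head graph_H f \<in> successors graph_H (tail graph_H f)" if "f \<in> arcs graph_H" for f
      using that unfolding successors_def by blast
    have succ: "head graph_H e \<in> successors graph_H (tail graph_H e)"
      "head graph_H e' \<in> successors graph_H (tail graph_H e)"
      using in_succ[OF e] in_succ[OF e'] tails by simp_all
    then have "head graph_H e = head graph_H e' \<or>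
        successors graph_H (head graph_H e) \<inter> successors graph_H (head graph_H e') \<noteq> {}"
      using common unfolding successors_graph_H by blast
    with succ show "(head graph_H e, head graph_H e') \<in>
        {(v, v'). v \<in> successors graph_H (tail graph_H e) \<and> v' \<in> successors graph_H (tail graph_H e) \<and>
                  successors graph_H v \<inter> successors graph_H v' \<noteq> {}}\<^sup>*"
      by (elim disjE) (simp, blast)
  qed
qed

end

theory Submission
  imports Defs
begin

text \<open>
  Write \<open>W\<close> for the degree one part of \<open>A(H)\<close> and \<open>R \<subseteq> W \<otimes> W\<close> for its quadratic relations.
  Distributivity already fails in \<open>W\<^sup>\<otimes>\<^sup>4\<close>, for the three subspaces \<open>X = R \<otimes> W \<otimes> W\<close>,
  \<open>Y = W \<otimes> R \<otimes> W\<close> and \<open>Z = W \<otimes> W \<otimes> R\<close>: one has \<open>Y \<inter> X = Y \<inter> Z = 0\<close>, but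
  \<open>Y \<inter> (X + Z) \<noteq> 0\<close>.

  Identify a vertex \<open>v\<close> with the sum of the edges of any path from \<open>v\<close> to \<open>*\<close>; this is well
  defined in \<open>A(H)\<close>, it makes \<open>* = 0\<close>, and the edge from \<open>u\<close> to \<open>v\<close> becomes \<open>u - v\<close>. Two
  paths \<open>u \<rightarrow> v \<rightarrow> z\<close> and \<open>u \<rightarrow> v' \<rightarrow> z\<close> give the relation \<open>(u - v)(v - z) - (u - v')(v' - z)\<close>,
  whose part of highest level is \<open>u (v - v')\<close>. In \<open>H\<close> there are five of these, one for each of the
  vertices \<open>a, x, y, w\<^sub>2, w\<^sub>3\<close>, and they span \<open>R\<close>; their leading parts are \<open>a (x - y)\<close>,
  \<open>x (w\<^sub>1 - w\<^sub>2)\<close>, \<open>y (w\<^sub>1 - w\<^sub>3)\<close>, \<open>w\<^sub>2 (p - q)\<close> and \<open>w\<^sub>3 (p - q)\<close>.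

  Consider \<open>a (x (w\<^sub>1 - w\<^sub>2) - y (w\<^sub>1 - w\<^sub>3)) (p - q)\<close>, which is of the form \<open>W \<otimes> R \<otimes> W\<close> as far
  as leading parts are concerned. Its terms \<open>a x w\<^sub>2 (p - q)\<close> and \<open>a y w\<^sub>3 (p - q)\<close> are of the
  form \<open>W \<otimes> W \<otimes> R\<close>, and what remains, \<open>a (x - y) w\<^sub>1 (p - q)\<close>, is of the form
  \<open>R \<otimes> W \<otimes> W\<close>. The lemma \<open>overlap_identity\<close> corrects this by terms of lower level to an exact
  identity \<open>\<eta> = \<xi> + \<zeta>\<close> with \<open>\<eta>\<close>, \<open>\<xi>\<close>, \<open>\<zeta>\<close> representing elements of \<open>Y\<close>, \<open>X\<close>, \<open>Z\<close>.

  If the lattice were distributive, \<open>\<eta>\<close> would lie in \<open>(Y \<inter> X) + (Y \<inter> Z)\<close>. This is refuted in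
  coordinates: a linear map from \<open>W\<close> to linear forms in letters induces a homomorphism \<open>\<Psi>\<close>
  from the tensor algebra to noncommutative polynomials, where coefficients can be compared.
  The coordinates are chosen with \<open>p \<mapsto> 0\<close>, which keeps the relations short. The image of
  \<open>R\<close> is bounded by \<open>arc_hom_graph_ideal\<close> and \<open>quadratic_relation_in_rel\<close>, and
  \<open>relations_do_not_overlap\<close> says that the images of \<open>R \<otimes> W\<close> and \<open>W \<otimes> R\<close> meet only in \<open>0\<close>. So
  \<open>\<Psi>\<close> kills \<open>(Y \<inter> X) + (Y \<inter> Z)\<close> but not \<open>\<eta>\<close>.
\<close>

section \<open>Coefficients of noncommutative polynomials\<close>

lemma lookup_times_words:
  fixes p q :: "'x list \<Rightarrow>\<^sub>0 'k::field"
  shows "Poly_Mapping.lookup (p * q) w =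
    (\<Sum>n\<le>length w. Poly_Mapping.lookup p (take n w) * Poly_Mapping.lookup q (drop n w))"
proof -
  let ?f = "\<lambda>l. Poly_Mapping.lookup p l * (\<Sum>r. Poly_Mapping.lookup q r when w = l + r)"
  have inner: "(\<Sum>r. Poly_Mapping.lookup q r when w = take n w + r) = Poly_Mapping.lookup q (drop n w)"
    for n
  proof -
    have "w = take n w + r \<longleftrightarrow> r = drop n w" for r
      unfolding plus_list_def by (metis append_take_drop_id same_append_eq)
    then show ?thesis by simp
  qed
  have "{l. ?f l \<noteq> 0} \<subseteq> (\<lambda>n. take n w) ` {..length w}"
  proof (intro subsetI, simp)
    fix l
    assume "Poly_Mapping.lookup p l \<noteq> 0 \<and> (\<Sum>r. Poly_Mapping.lookup q r when w = l + r) \<noteq> 0"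
    then obtain r where "(Poly_Mapping.lookup q r when w = l + r) \<noteq> 0"
      by (meson Sum_any.not_neutral_obtains_not_neutral)
    then have "w = l + r" by (simp add: when_def split: if_splits)
    then show "l \<in> (\<lambda>n. take n w) ` {..length w}"
      by (intro image_eqI[of _ _ "length l"]) (auto simp: plus_list_def)
  qed
  then have "(\<Sum>l. ?f l) = sum ?f ((\<lambda>n. take n w) ` {..length w})"
    by (intro Sum_any.expand_superset) auto
  also have "\<dots> = (\<Sum>n\<le>length w. ?f (take n w))"
    by (subst sum.reindex) (auto simp: inj_on_def dest: arg_cong[where f = length])
  finally show ?thesis
    by (simp only: lookup_mult inner)
qed

lemma lookup_scalar_times:
  "Poly_Mapping.lookup (Poly_Mapping.single [] c * p) w = c * Poly_Mapping.lookup p w"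
  for p :: "'x list \<Rightarrow>\<^sub>0 'k::field"
proof -
  have "(\<Sum>n\<le>length w. Poly_Mapping.lookup (Poly_Mapping.single [] c) (take n w)
      * Poly_Mapping.lookup p (drop n w)) = (\<Sum>n\<in>{0}. c * Poly_Mapping.lookup p (drop n w))"
    by (rule sum.mono_neutral_cong_right) (auto simp: lookup_single when_def)
  then show ?thesis by (simp add: lookup_times_words)
qed

lemma scalar_commutes:
  "p * Poly_Mapping.single [] c = Poly_Mapping.single [] c * p"
  for p :: "'x list \<Rightarrow>\<^sub>0 'k::field"
proof (rule poly_mapping_eqI)
  fix w
  have "(\<Sum>n\<le>length w. Poly_Mapping.lookup p (take n w)
      * Poly_Mapping.lookup (Poly_Mapping.single [] c) (drop n w))
      = (\<Sum>n\<in>{length w}. Poly_Mapping.lookup p (take n w) * c)"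
    by (rule sum.mono_neutral_cong_right) (auto simp: lookup_single when_def)
  then show "Poly_Mapping.lookup (p * Poly_Mapping.single [] c) w =
      Poly_Mapping.lookup (Poly_Mapping.single [] c * p) w"
    unfolding lookup_scalar_times by (simp add: lookup_times_words mult.commute)
qed

lemma lookup_letter: "Poly_Mapping.lookup (letter x) w = (if w = [x] then 1 else 0)"
  by (auto simp: letter_def lookup_single when_def)

lemma free_algebra_sel [simp]:
  "carrier (free_algebra X) = {p. Poly_Mapping.keys p \<subseteq> lists X}"
  "p \<otimes>\<^bsub>free_algebra X\<^esub> q = p * q" "\<one>\<^bsub>free_algebra X\<^esub> = 1" "\<zero>\<^bsub>free_algebra X\<^esub> = 0"
  "p \<oplus>\<^bsub>free_algebra X\<^esub> q = p + q" "c \<odot>\<^bsub>free_algebra X\<^esub> p = Poly_Mapping.single [] c * p"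
  by (simp_all add: free_algebra_def)

lemma free_algebra_deg_iff:
  "p \<in> free_algebra_deg X n \<longleftrightarrow>
    (\<forall>w. Poly_Mapping.lookup p w \<noteq> 0 \<longrightarrow> set w \<subseteq> X \<and> length w = n)"
  by (auto simp: free_algebra_deg_def in_keys_iff lists_eq_set)

lemma free_algebra_deg_subset: "free_algebra_deg X n \<subseteq> carrier (free_algebra X)"
  by (auto simp: free_algebra_deg_def)

lemma free_algebra_deg_add:
  "p \<in> free_algebra_deg X n \<Longrightarrow> q \<in> free_algebra_deg X n \<Longrightarrow> p + q \<in> free_algebra_deg X n"
  by (simp add: free_algebra_deg_iff lookup_add) (metis add.right_neutral)

lemma free_algebra_deg_diff:
  "p \<in> free_algebra_deg X n \<Longrightarrow> q \<in> free_algebra_deg X n \<Longrightarrow> p - q \<in> free_algebra_deg X n"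
  by (simp add: free_algebra_deg_iff lookup_minus) (metis diff_zero)

lemma free_algebra_deg_zero: "0 \<in> free_algebra_deg X n"
  by (simp add: free_algebra_deg_iff)

lemma free_algebra_deg_one: "1 \<in> free_algebra_deg X 0"
  by (simp add: free_algebra_deg_iff lookup_one when_def zero_list_def)

lemma free_algebra_deg_letter: "x \<in> X \<Longrightarrow> letter x \<in> free_algebra_deg X 1"
  by (simp add: free_algebra_deg_iff lookup_letter)

lemma free_algebra_deg_mult:
  assumes "p \<in> free_algebra_deg X m" "q \<in> free_algebra_deg X n"
  shows "p * q \<in> free_algebra_deg X (m + n)"
  unfolding free_algebra_deg_iff
proof (intro allI impI)
  fix w
  assume "Poly_Mapping.lookup (p * q) w \<noteq> 0"
  then have "w \<in> Poly_Mapping.keys (p * q)" by (simp add: in_keys_iff)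
  then obtain u v where "w = u @ v" "u \<in> Poly_Mapping.keys p" "v \<in> Poly_Mapping.keys q"
    using keys_mult[of p q] by (auto simp: plus_list_def)
  then show "set w \<subseteq> X \<and> length w = m + n"
    using assms by (auto simp: free_algebra_deg_iff in_keys_iff)
qed

lemma free_algebra_deg_scalar:
  "p \<in> free_algebra_deg X n \<Longrightarrow> Poly_Mapping.single [] c * p \<in> free_algebra_deg X n"
  by (auto simp: free_algebra_deg_iff lookup_scalar_times)

text \<open>
  If the left factor is homogeneous, only one way of splitting the word contributes. All
  coefficient computations below cut words at known places by this rule.
\<close>

lemma lookup_times_deg:
  fixes p q :: "'x list \<Rightarrow>\<^sub>0 'k::field"
  assumes p: "p \<in> free_algebra_deg X n" and "n \<le> length w"
  shows "Poly_Mapping.lookup (p * q) w =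
    Poly_Mapping.lookup p (take n w) * Poly_Mapping.lookup q (drop n w)"
proof -
  have "(\<Sum>m\<le>length w. Poly_Mapping.lookup p (take m w) * Poly_Mapping.lookup q (drop m w)) =
      (\<Sum>m\<in>{n}. Poly_Mapping.lookup p (take m w) * Poly_Mapping.lookup q (drop m w))"
  proof (rule sum.mono_neutral_right)
    show "\<forall>m\<in>{..length w} - {n}. Poly_Mapping.lookup p (take m w) * Poly_Mapping.lookup q (drop m w) = 0"
    proof
      fix m
      assume "m \<in> {..length w} - {n}"
      then have "length (take m w) \<noteq> n" by simp
      then have "Poly_Mapping.lookup p (take m w) = 0"
        using p unfolding free_algebra_deg_iff by blast
      then show "Poly_Mapping.lookup p (take m w) * Poly_Mapping.lookup q (drop m w) = 0" by simp
    qed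
  qed (use \<open>n \<le> length w\<close> in auto)
  then show ?thesis by (simp add: lookup_times_words)
qed


lemma lookup_letter_times_Cons [simp]:
  "Poly_Mapping.lookup (letter x * p) (y # w) = (if x = y then Poly_Mapping.lookup p w else 0)"
  for p :: "'x list \<Rightarrow>\<^sub>0 'k::field"
  using lookup_times_deg[OF free_algebra_deg_letter[of x UNIV], of "y # w" p]
  by (simp add: lookup_letter)


section \<open>Algebras, their homomorphisms and quotients\<close>

locale assoc_algebra = ring A for A :: "('k::field, 'a) module" (structure) +
  assumes smult_closed [simp, intro]: "x \<in> carrier A \<Longrightarrow> c \<odot> x \<in> carrier A"
    and smult_l_distr: "x \<in> carrier A \<Longrightarrow> (c + d) \<odot> x = c \<odot> x \<oplus> d \<odot> x"
    and smult_r_distr: "x \<in> carrier A \<Longrightarrow> y \<in> carrier A \<Longrightarrow> c \<odot> (x \<oplus> y) = c \<odot> x \<oplus> c \<odot> y"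
    and smult_smult: "x \<in> carrier A \<Longrightarrow> c \<odot> (d \<odot> x) = (c * d) \<odot> x"
    and smult_one [simp]: "x \<in> carrier A \<Longrightarrow> 1 \<odot> x = x"
    and smult_mult_left: "x \<in> carrier A \<Longrightarrow> y \<in> carrier A \<Longrightarrow> (c \<odot> x) \<otimes> y = c \<odot> (x \<otimes> y)"
    and smult_mult_right: "x \<in> carrier A \<Longrightarrow> y \<in> carrier A \<Longrightarrow> x \<otimes> (c \<odot> y) = c \<odot> (x \<otimes> y)"
begin

lemma smult_zero_left [simp]:
  assumes "x \<in> carrier A"
  shows "0 \<odot> x = \<zero>"
proof -
  have "0 \<odot> x \<oplus> 0 \<odot> x = 0 \<odot> x" using smult_l_distr[of x 0 0] assms by simp
  then show ?thesis using assms by (metis add.r_cancel_one' smult_closed)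
qed

lemma smult_zero_right [simp]: "c \<odot> \<zero> = \<zero>"
  using smult_smult[of \<zero> c 0] by simp

lemma smult_minus_one:
  assumes "x \<in> carrier A"
  shows "(-1) \<odot> x = \<ominus> x"
proof -
  have "(-1) \<odot> x \<oplus> x = \<zero>"
    using smult_l_distr[of x "-1" 1] assms by simp
  then show ?thesis using assms by (simp add: minus_equality)
qed

lemma linear_span_subset:
  assumes "S \<subseteq> carrier A"
  shows "linear_span A S \<subseteq> carrier A"
proof
  fix x assume "x \<in> linear_span A S"
  then show "x \<in> carrier A" by induction (use assms in auto)
qed

lemma linear_span_base:
  assumes "S \<subseteq> carrier A" "x \<in> S"
  shows "x \<in> linear_span A S"
proof -
  have "x \<in> carrier A" using assms by blast
  then show ?thesis
    using linear_span.add[OF \<open>x \<in> S\<close> linear_span.zero[of A S], of 1] by simp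
qed

lemma linear_span_add:
  assumes S: "S \<subseteq> carrier A" and "x \<in> linear_span A S" and y: "y \<in> linear_span A S"
  shows "x \<oplus> y \<in> linear_span A S"
  using assms(2)
proof induction
  case zero
  then show ?case using y linear_span_subset[OF S] by auto
next
  case (add u v c)
  then have "c \<odot> u \<oplus> v \<oplus> y = c \<odot> u \<oplus> (v \<oplus> y)"
    using S y linear_span_subset[OF S] by (intro a_assoc) auto
  then show ?case using add by (simp add: linear_span.add)
qed

end

text \<open>
  Scalars are an extra operation of the record, not given by a ring element, so that compatibility
  with them has to be asked for on top of \<open>ring_hom\<close>.
\<close>

definition algebra_hom :: "('k, 'a) module \<Rightarrow> ('k, 'b) module \<Rightarrow> ('a \<Rightarrow> 'b) set" where
  "algebra_hom A B =
    {h \<in> ring_hom A B. \<forall>c. \<forall>x\<in>carrier A. h (c \<odot>\<^bsub>A\<^esub> x) = c \<odot>\<^bsub>B\<^esub> h x}"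

lemma algebra_homD:
  assumes "h \<in> algebra_hom A B"
  shows "x \<in> carrier A \<Longrightarrow> h x \<in> carrier B"
    and "x \<in> carrier A \<Longrightarrow> y \<in> carrier A \<Longrightarrow> h (x \<oplus>\<^bsub>A\<^esub> y) = h x \<oplus>\<^bsub>B\<^esub> h y"
    and "x \<in> carrier A \<Longrightarrow> y \<in> carrier A \<Longrightarrow> h (x \<otimes>\<^bsub>A\<^esub> y) = h x \<otimes>\<^bsub>B\<^esub> h y"
    and "h \<one>\<^bsub>A\<^esub> = \<one>\<^bsub>B\<^esub>"
    and "x \<in> carrier A \<Longrightarrow> h (c \<odot>\<^bsub>A\<^esub> x) = c \<odot>\<^bsub>B\<^esub> h x"
  using assms by (auto simp: algebra_hom_def ring_hom_def)

lemma algebra_hom_zero: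
  assumes "assoc_algebra A" "assoc_algebra B" "h \<in> algebra_hom A B"
  shows "h \<zero>\<^bsub>A\<^esub> = \<zero>\<^bsub>B\<^esub>"
proof -
  interpret A: assoc_algebra A by fact
  interpret B: assoc_algebra B by fact
  have "h (0 \<odot>\<^bsub>A\<^esub> \<zero>\<^bsub>A\<^esub>) = 0 \<odot>\<^bsub>B\<^esub> h \<zero>\<^bsub>A\<^esub>"
    by (rule algebra_homD(5)[OF assms(3)]) simp
  then show ?thesis using algebra_homD(1)[OF assms(3), of "\<zero>\<^bsub>A\<^esub>"] by simp
qed

lemma assoc_algebra_free: "assoc_algebra (free_algebra X :: ('k::field, 'x list \<Rightarrow>\<^sub>0 'k) module)"
proof -
  let ?F = "free_algebra X :: ('k, 'x list \<Rightarrow>\<^sub>0 'k) module"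
  have iff: "Poly_Mapping.keys p \<subseteq> lists X \<longleftrightarrow> (\<forall>w. Poly_Mapping.lookup p w \<noteq> 0 \<longrightarrow> set w \<subseteq> X)"
    for p :: "'x list \<Rightarrow>\<^sub>0 'k"
    by (auto simp: in_keys_iff lists_eq_set)
  have add: "Poly_Mapping.keys (p + q) \<subseteq> lists X"
    if "Poly_Mapping.keys p \<subseteq> lists X" "Poly_Mapping.keys q \<subseteq> lists X" for p q :: "'x list \<Rightarrow>\<^sub>0 'k"
    using keys_add[of p q] that by blast
  have minus: "Poly_Mapping.keys (- p) \<subseteq> lists X"
    if "Poly_Mapping.keys p \<subseteq> lists X" for p :: "'x list \<Rightarrow>\<^sub>0 'k"
    using that by (simp add: iff)
  have mult: "Poly_Mapping.keys (p * q) \<subseteq> lists X"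
    if "Poly_Mapping.keys p \<subseteq> lists X" "Poly_Mapping.keys q \<subseteq> lists X" for p q :: "'x list \<Rightarrow>\<^sub>0 'k"
    using keys_mult[of p q] that by (fastforce simp: plus_list_def)
  have scal: "Poly_Mapping.keys (Poly_Mapping.single [] c * p) \<subseteq> lists X"
    if "Poly_Mapping.keys p \<subseteq> lists X" for c and p :: "'x list \<Rightarrow>\<^sub>0 'k"
    using that by (intro mult) simp_all
  have "abelian_group ?F"
    by (rule abelian_groupI) (auto simp: add algebra_simps intro!: exI[of _ "- _"] minus)
  moreover have "monoid ?F"
    by (rule monoidI) (auto simp: mult zero_list_def mult.assoc)
  ultimately have "ring ?F"
    by (rule ringI) (auto simp: algebra_simps)
  then show ?thesis
  proof (rule assoc_algebra.intro, unfold_locales)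
    show "c \<odot>\<^bsub>?F\<^esub> x \<in> carrier ?F" if "x \<in> carrier ?F" for c x
      using that scal by simp
    show "(c + d) \<odot>\<^bsub>?F\<^esub> x = c \<odot>\<^bsub>?F\<^esub> x \<oplus>\<^bsub>?F\<^esub> d \<odot>\<^bsub>?F\<^esub> x" for c d x
      by (simp add: single_add distrib_right)
    show "c \<odot>\<^bsub>?F\<^esub> (d \<odot>\<^bsub>?F\<^esub> x) = (c * d) \<odot>\<^bsub>?F\<^esub> x" for c d x
      by (simp add: mult_single plus_list_def flip: mult.assoc)
    show "1 \<odot>\<^bsub>?F\<^esub> x = x" for x
      by (simp flip: zero_list_def)
    show "x \<otimes>\<^bsub>?F\<^esub> (c \<odot>\<^bsub>?F\<^esub> y) = c \<odot>\<^bsub>?F\<^esub> (x \<otimes>\<^bsub>?F\<^esub> y)" for c x y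
      by (metis free_algebra_sel(2,6) mult.assoc scalar_commutes)
  qed (simp_all add: algebra_simps)
qed

lemma free_algebra_closed:
  fixes p q :: "'x list \<Rightarrow>\<^sub>0 'k::field"
  assumes "p \<in> carrier (free_algebra X)" "q \<in> carrier (free_algebra X)"
  shows "p + q \<in> carrier (free_algebra X)" "p * q \<in> carrier (free_algebra X)"
    "p - q \<in> carrier (free_algebra X)"
proof -
  interpret F: assoc_algebra "free_algebra X :: ('k, _) module" by (rule assoc_algebra_free)
  show "p + q \<in> carrier (free_algebra X)" "p * q \<in> carrier (free_algebra X)"
    using F.a_closed[OF assms] F.m_closed[OF assms] unfolding free_algebra_sel(2,5) .
  show "p - q \<in> carrier (free_algebra X)"
    using keys_diff[of p q] assms unfolding free_algebra_sel(1) by blast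
qed

lemma quotient_algebra_sel [simp]:
  "carrier (quotient_algebra T J) = a_rcosets\<^bsub>T\<^esub> J"
  "C \<otimes>\<^bsub>quotient_algebra T J\<^esub> D = [mod J:] C \<Otimes>\<^bsub>T\<^esub> D"
  "\<one>\<^bsub>quotient_algebra T J\<^esub> = J +>\<^bsub>T\<^esub> \<one>\<^bsub>T\<^esub>"
  "\<zero>\<^bsub>quotient_algebra T J\<^esub> = J"
  "C \<oplus>\<^bsub>quotient_algebra T J\<^esub> D = C <+>\<^bsub>T\<^esub> D"
  "c \<odot>\<^bsub>quotient_algebra T J\<^esub> C = (\<Union>x\<in>C. J +>\<^bsub>T\<^esub> (c \<odot>\<^bsub>T\<^esub> x))"
  by (simp_all add: quotient_algebra_def FactRing_def ring.defs module.defs)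

locale algebra_ideal = assoc_algebra A + ideal J A for A :: "('k::field, 'a) module" (structure) and J
begin

abbreviation Q :: "('k, 'a set) module" where "Q \<equiv> quotient_algebra A J"

lemma carrier_quotient: "carrier Q = (\<lambda>x. J +> x) ` carrier A"
  by (auto simp: A_RCOSETS_def')

lemma coset_eq_iff:
  assumes "x \<in> carrier A" "y \<in> carrier A"
  shows "J +> x = J +> y \<longleftrightarrow> x \<ominus> y \<in> J"
  using assms by (simp add: quotient_eq_iff_same_a_r_cos[OF ideal_axioms])

lemma smult_mem: "x \<in> J \<Longrightarrow> c \<odot> x \<in> J"
  using I_l_closed[of x "c \<odot> \<one>"] smult_mult_left[of \<one> x c] by (simp add: Icarr)

text \<open>
  The scalar multiple of a coset is formed as a union over all representatives. It is a single
  coset because a two-sided ideal is closed under scalars: \<open>c \<odot> x = (c \<odot> \<one>) \<otimes> x\<close>.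
\<close>

lemma quotient_smult:
  assumes "x \<in> carrier A"
  shows "c \<odot>\<^bsub>Q\<^esub> (J +> x) = J +> (c \<odot> x)"
proof -
  have "J +> (c \<odot> y) = J +> (c \<odot> x)" if y: "y \<in> J +> x" for y
  proof -
    from y obtain j where j: "j \<in> J" "y = j \<oplus> x" by (auto simp: a_r_coset_def')
    then have "c \<odot> y = c \<odot> j \<oplus> c \<odot> x" using assms by (simp add: smult_r_distr Icarr)
    then have "J +> (c \<odot> y) = (J +> c \<odot> j) <+> (J +> c \<odot> x)"
      using assms j by (simp add: a_rcos_sum Icarr)
    also have "J +> c \<odot> j = J +> \<zero>"
      using j smult_mem[of j c] by (subst coset_eq_iff) (auto simp: a_minus_def Icarr)
    also have "(J +> \<zero>) <+> (J +> c \<odot> x) = J +> c \<odot> x"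
      using assms by (simp add: a_rcos_sum)
    finally show ?thesis .
  qed
  moreover have "x \<in> J +> x" using assms by (rule a_rcos_self)
  ultimately have "(\<Union>y\<in>J +> x. J +> (c \<odot> y)) = J +> (c \<odot> x)" by blast
  then show ?thesis by simp
qed

lemma quotient_ops:
  assumes "x \<in> carrier A" "y \<in> carrier A"
  shows "(J +> x) \<oplus>\<^bsub>Q\<^esub> (J +> y) = J +> (x \<oplus> y)"
    and "(J +> x) \<otimes>\<^bsub>Q\<^esub> (J +> y) = J +> (x \<otimes> y)"
  using assms by (simp_all add: a_rcos_sum rcoset_mult_add)

lemma coset_zero: "J +> \<zero> = \<zero>\<^bsub>Q\<^esub>"
  by (simp add: a_coset_add_zero a_subset)

lemma assoc_algebra_quotient: "assoc_algebra Q"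
proof -
  have car: "carrier Q = (\<lambda>x. J +> x) ` carrier A" by (rule carrier_quotient)
  note ops = quotient_ops quotient_smult
  have "abelian_group Q"
  proof (rule abelian_groupI, unfold car coset_zero[symmetric], safe)
    fix x assume x: "x \<in> carrier A"
    show "\<exists>y\<in>(+>) J ` carrier A. y \<oplus>\<^bsub>Q\<^esub> (J +> x) = J +> \<zero>"
      by (rule bexI[of _ "J +> (\<ominus> x)"]) (use x in \<open>simp_all add: ops l_neg del: quotient_algebra_sel\<close>)
  qed (auto simp: ops a_ac simp del: quotient_algebra_sel)
  moreover have "monoid Q"
    by (rule monoidI, unfold car quotient_algebra_sel(3))
      (auto simp: ops m_assoc simp del: quotient_algebra_sel)
  ultimately have "ring Q"
    by (rule ringI, unfold car) (auto simp: ops l_distr r_distr simp del: quotient_algebra_sel)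
  then show ?thesis
    by (rule assoc_algebra.intro, unfold_locales, unfold car)
      (auto simp: ops smult_l_distr smult_r_distr smult_smult smult_mult_left smult_mult_right
        simp del: quotient_algebra_sel)
qed

lemma coset_algebra_hom: "(\<lambda>x. J +> x) \<in> algebra_hom A Q"
  unfolding algebra_hom_def
  by (auto intro!: ring_hom_memI simp: quotient_ops quotient_smult carrier_quotient
      simp del: quotient_algebra_sel(1,2,4,5,6))

text \<open>
  The homomorphism induced on the quotient, in the form in which \<open>tensor_eval\<close> is given: the
  image of a coset is a singleton.
\<close>

lemma induced_hom_coset:
  assumes B: "assoc_algebra B" and h: "h \<in> algebra_hom A B"
    and kill: "\<And>x. x \<in> J \<Longrightarrow> h x = \<zero>\<^bsub>B\<^esub>" and x: "x \<in> carrier A"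
  shows "the_elem (h ` (J +> x)) = h x"
proof -
  interpret B: assoc_algebra B by fact
  have "h y = h x" if "y \<in> J +> x" for y
  proof -
    from that obtain j where j: "j \<in> J" "y = j \<oplus> x" by (auto simp: a_r_coset_def')
    then show ?thesis
      using x h by (simp add: algebra_homD[OF h] kill Icarr)
  qed
  moreover have "x \<in> J +> x" using x by (rule a_rcos_self)
  ultimately have "h ` (J +> x) = {h x}" by blast
  then show ?thesis by simp
qed

lemma induced_algebra_hom:
  assumes B: "assoc_algebra B" and h: "h \<in> algebra_hom A B"
    and kill: "\<And>x. x \<in> J \<Longrightarrow> h x = \<zero>\<^bsub>B\<^esub>"
  shows "(\<lambda>C. the_elem (h ` C)) \<in> algebra_hom Q B"
proof -
  note val = induced_hom_coset[OF B h kill]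
  note hom = algebra_homD[OF h]
  show ?thesis
    unfolding algebra_hom_def
    by (auto intro!: ring_hom_memI simp: quotient_ops quotient_smult carrier_quotient hom val
        simp del: quotient_algebra_sel(1,2,4,5,6))
qed

end

lemma ideal_vimage:
  assumes A: "assoc_algebra A" and B: "assoc_algebra B" and h: "h \<in> algebra_hom A B"
    and I: "ideal I B"
  shows "ideal {x \<in> carrier A. h x \<in> I} A"
proof -
  interpret A: assoc_algebra A by fact
  interpret B: assoc_algebra B by fact
  interpret I: ideal I B by fact
  interpret ring_hom_ring A B h
    using h by (intro ring_hom_ringI2) (auto simp: algebra_hom_def A.ring_axioms B.ring_axioms)
  show ?thesis
  proof (rule idealI)
    show "subgroup {x \<in> carrier A. h x \<in> I} (add_monoid A)"
      by (rule A.add.subgroupI) (auto simp flip: a_inv_def intro: I.additive_subgroup_axioms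
          exI[of _ "\<zero>\<^bsub>A\<^esub>"] I.zero_closed)
  qed (auto simp: A.ring_axioms I.I_l_closed I.I_r_closed)
qed

text \<open>
  Membership in an ideal given by generators cannot be refuted from its definition directly. The ideal is
  bounded instead by pulling back, along a homomorphism, an ideal with an explicit description.
\<close>

lemma genideal_hom_subset:
  assumes A: "assoc_algebra A" and B: "assoc_algebra B" and h: "h \<in> algebra_hom A B"
    and I: "ideal I B" and S: "S \<subseteq> carrier A" "\<And>x. x \<in> S \<Longrightarrow> h x \<in> I"
    and x: "x \<in> genideal A S"
  shows "h x \<in> I"
proof -
  interpret A: assoc_algebra A by fact
  have "genideal A S \<subseteq> {x \<in> carrier A. h x \<in> I}"
    by (rule A.genideal_minimal[OF ideal_vimage[OF A B h I]]) (use S in auto)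
  then show ?thesis using x by blast
qed


section \<open>Evaluation of noncommutative polynomials\<close>

definition word_value :: "('k, 'a) module \<Rightarrow> ('x \<Rightarrow> 'a) \<Rightarrow> 'x list \<Rightarrow> 'a" where
  "word_value A f ws = foldr (\<lambda>x y. f x \<otimes>\<^bsub>A\<^esub> y) ws \<one>\<^bsub>A\<^esub>"

text \<open>
  The homomorphism from a free algebra prescribed on letters. Taking \<open>f\<close> as a parameter, rather than
  letting the letters be elements of the target as \<open>free_eval\<close> does, covers at once the evaluation
  map, changes of coordinates and the choice of representatives.
\<close>

definition poly_value :: "('k::zero, 'a) module \<Rightarrow> ('x \<Rightarrow> 'a) \<Rightarrow> ('x list \<Rightarrow>\<^sub>0 'k) \<Rightarrow> 'a" where
  "poly_value A f p = (\<Oplus>\<^bsub>A\<^esub>ws\<in>Poly_Mapping.keys p.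
     Poly_Mapping.lookup p ws \<odot>\<^bsub>A\<^esub> word_value A f ws)"

lemma free_eval_eq_poly_value: "free_eval A = poly_value A (\<lambda>x. x)"
  by (simp add: fun_eq_iff free_eval_def poly_value_def word_value_def)

lemma keys_subset_induct [consumes 1, case_names zero single_add]:
  fixes p :: "'x \<Rightarrow>\<^sub>0 'k::field"
  assumes "Poly_Mapping.keys p \<subseteq> S" and "P 0"
    and "\<And>w c p. w \<in> S \<Longrightarrow> Poly_Mapping.keys p \<subseteq> S \<Longrightarrow> P p \<Longrightarrow> P (Poly_Mapping.single w c + p)"
  shows "P p"
  using assms(1)
proof (induction p rule: update_induct)
  case const
  show ?case by (fact assms(2))
next
  case (update p w c)
  have "Poly_Mapping.update w c p = Poly_Mapping.single w c + p"
    using \<open>w \<notin> Poly_Mapping.keys p\<close>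
    by (intro poly_mapping_eqI)
      (auto simp: lookup_update lookup_add lookup_single when_def in_keys_iff)
  moreover have "w \<in> S" "Poly_Mapping.keys p \<subseteq> S"
    using update.prems \<open>c \<noteq> 0\<close> \<open>w \<notin> Poly_Mapping.keys p\<close> by (auto simp: keys_update split: if_splits)
  ultimately show ?case using update.IH assms(3) by simp
qed

context assoc_algebra
begin

lemma word_value_Nil [simp]: "word_value A f [] = \<one>"
  by (simp add: word_value_def)

lemma word_value_Cons [simp]: "word_value A f (x # w) = f x \<otimes> word_value A f w"
  by (simp add: word_value_def)

lemma word_value_closed [intro]:
  "f \<in> X \<rightarrow> carrier A \<Longrightarrow> set w \<subseteq> X \<Longrightarrow> word_value A f w \<in> carrier A"
  by (induction w) auto

lemma word_value_append:
  "f \<in> X \<rightarrow> carrier A \<Longrightarrow> set v \<subseteq> X \<Longrightarrow> set w \<subseteq> X \<Longrightarrow>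
    word_value A f (v @ w) = word_value A f v \<otimes> word_value A f w"
proof (induction v)
  case Nil
  then have "word_value A f w \<in> carrier A" by (rule_tac word_value_closed)
  then show ?case by simp
next
  case (Cons x v)
  then have "word_value A f v \<in> carrier A" "word_value A f w \<in> carrier A" "f x \<in> carrier A"
    by (auto intro: word_value_closed)
  then show ?case using Cons by (simp add: m_assoc)
qed

lemma poly_value_superset:
  assumes f: "f \<in> X \<rightarrow> carrier A" and "finite S" "Poly_Mapping.keys p \<subseteq> S" "S \<subseteq> lists X"
  shows "poly_value A f p = (\<Oplus>w\<in>S. Poly_Mapping.lookup p w \<odot> word_value A f w)"
  unfolding poly_value_def
proof (rule add.finprod_mono_neutral_cong_left)
  have closed: "word_value A f w \<in> carrier A" if "w \<in> S" for w
    using that f \<open>S \<subseteq> lists X\<close> by (auto simp: lists_eq_set)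
  then show "(\<lambda>w. Poly_Mapping.lookup p w \<odot> word_value A f w) \<in> S \<rightarrow> carrier A" by auto
  show "Poly_Mapping.lookup p w \<odot> word_value A f w = \<zero>" if "w \<in> S - Poly_Mapping.keys p" for w
    using that closed by (simp add: in_keys_iff)
qed (use assms in auto)

lemma poly_value_closed:
  assumes f: "f \<in> X \<rightarrow> carrier A" and "p \<in> carrier (free_algebra X)"
  shows "poly_value A f p \<in> carrier A"
proof -
  have "word_value A f w \<in> carrier A" if "w \<in> Poly_Mapping.keys p" for w
    using that assms by (auto simp: lists_eq_set)
  then show ?thesis unfolding poly_value_def by (intro finsum_closed) auto
qed

lemma poly_value_zero [simp]: "poly_value A f 0 = \<zero>"
  by (simp add: poly_value_def)

lemma poly_value_add:
  assumes f: "f \<in> X \<rightarrow> carrier A"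
    and p: "p \<in> carrier (free_algebra X)" and q: "q \<in> carrier (free_algebra X)"
  shows "poly_value A f (p + q) = poly_value A f p \<oplus> poly_value A f q"
proof -
  let ?S = "Poly_Mapping.keys p \<union> Poly_Mapping.keys q"
  have S: "finite ?S" "?S \<subseteq> lists X" using p q by auto
  have closed: "word_value A f w \<in> carrier A" if "w \<in> ?S" for w
  proof -
    have "set w \<subseteq> X" using that S(2) unfolding lists_eq_set by blast
    then show ?thesis by (rule word_value_closed[OF f])
  qed
  have "poly_value A f (p + q) = (\<Oplus>w\<in>?S. Poly_Mapping.lookup (p + q) w \<odot> word_value A f w)"
    using keys_add by (rule poly_value_superset[OF f S(1) _ S(2)])
  also have "\<dots> = (\<Oplus>w\<in>?S. Poly_Mapping.lookup p w \<odot> word_value A f w \<oplus>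
      Poly_Mapping.lookup q w \<odot> word_value A f w)"
    by (rule finsum_cong') (auto simp: lookup_add smult_l_distr closed)
  also have "\<dots> = (\<Oplus>w\<in>?S. Poly_Mapping.lookup p w \<odot> word_value A f w) \<oplus>
      (\<Oplus>w\<in>?S. Poly_Mapping.lookup q w \<odot> word_value A f w)"
    by (rule finsum_addf) (auto simp: closed)
  finally show ?thesis
    using poly_value_superset[OF f S(1) _ S(2)] by simp
qed

lemma poly_value_single:
  assumes f: "f \<in> X \<rightarrow> carrier A" and w: "set w \<subseteq> X"
  shows "poly_value A f (Poly_Mapping.single w c) = c \<odot> word_value A f w"
proof -
  have "word_value A f w \<in> carrier A" using f w by auto
  then show ?thesis by (simp add: poly_value_def finsum_insert)
qed

lemma poly_value_letter:
  "f x \<in> carrier A \<Longrightarrow> poly_value A f (letter x) = f x"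
  using poly_value_single[of f "{x}" "[x]" 1] by (simp add: letter_def)

lemma poly_value_single_mult:
  assumes f: "f \<in> X \<rightarrow> carrier A" and v: "set v \<subseteq> X" and q: "q \<in> carrier (free_algebra X)"
  shows "poly_value A f (Poly_Mapping.single v c * q) = c \<odot> word_value A f v \<otimes> poly_value A f q"
proof -
  have single: "Poly_Mapping.single w d \<in> carrier (free_algebra X)" if "set w \<subseteq> X" for w and d :: 'k
    using that by (auto simp: lists_eq_set)
  have val: "word_value A f w \<in> carrier A" if "set w \<subseteq> X" for w
    using that f by auto
  from q have "Poly_Mapping.keys q \<subseteq> lists X" by simp
  then show ?thesis
  proof (induction q rule: keys_subset_induct)
    case zero
    then show ?case using val[OF v] by simp
  next
    case (single_add w d p)
    then have w: "set w \<subseteq> X" and p: "p \<in> carrier (free_algebra X)" by (auto simp: lists_eq_set)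
    have vw: "set (v @ w) \<subseteq> X" using v w by simp
    have "poly_value A f (Poly_Mapping.single v c * (Poly_Mapping.single w d + p)) =
        poly_value A f (Poly_Mapping.single (v @ w) (c * d) + Poly_Mapping.single v c * p)"
      by (simp add: distrib_left mult_single plus_list_def)
    also have "\<dots> = (c * d) \<odot> word_value A f (v @ w) \<oplus> (c \<odot> word_value A f v) \<otimes> poly_value A f p"
      using poly_value_add[OF f single[OF vw] free_algebra_closed(2)[OF single[OF v] p]]
      by (simp only: poly_value_single[OF f vw] single_add.IH)
    also have "(c * d) \<odot> word_value A f (v @ w) = (c \<odot> word_value A f v) \<otimes> (d \<odot> word_value A f w)"
      using val[OF v] val[OF w]
      by (simp add: word_value_append[OF f v w] smult_mult_left smult_mult_right smult_smult mult.commute)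
    also have "(c \<odot> word_value A f v) \<otimes> (d \<odot> word_value A f w) \<oplus> (c \<odot> word_value A f v) \<otimes> poly_value A f p =
       (c \<odot> word_value A f v) \<otimes> (d \<odot> word_value A f w \<oplus> poly_value A f p)"
      using val[OF v] val[OF w] poly_value_closed[OF f p] by (simp add: r_distr)
    also have "d \<odot> word_value A f w \<oplus> poly_value A f p = poly_value A f (Poly_Mapping.single w d + p)"
      using poly_value_add[OF f single[OF w] p] by (simp only: poly_value_single[OF f w])
    finally show ?case .
  qed
qed

lemma poly_value_mult:
  assumes f: "f \<in> X \<rightarrow> carrier A"
    and p: "p \<in> carrier (free_algebra X)" and q: "q \<in> carrier (free_algebra X)"
  shows "poly_value A f (p * q) = poly_value A f p \<otimes> poly_value A f q"
proof -
  from p have "Poly_Mapping.keys p \<subseteq> lists X" by simp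
  then show ?thesis
  proof (induction p rule: keys_subset_induct)
    case zero
    then show ?case using poly_value_closed[OF f q] by simp
  next
    case (single_add w d p)
    then have w: "set w \<subseteq> X" and p: "p \<in> carrier (free_algebra X)" by (auto simp: lists_eq_set)
    have s: "Poly_Mapping.single w d \<in> carrier (free_algebra X)" using w by (auto simp: lists_eq_set)
    have "word_value A f w \<in> carrier A" using f w by auto
    then show ?case
      using poly_value_add[OF f free_algebra_closed(2)[OF s q] free_algebra_closed(2)[OF p q]] poly_value_add[OF f s p]
        poly_value_single_mult[OF f w q] poly_value_single[OF f w] single_add.IH
        poly_value_closed[OF f p] poly_value_closed[OF f q]
      by (simp add: distrib_right l_distr)
  qed
qed

lemma poly_value_algebra_hom:
  assumes f: "f \<in> X \<rightarrow> carrier A"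
  shows "poly_value A f \<in> algebra_hom (free_algebra X) A"
proof -
  have one: "poly_value A f 1 = \<one>"
    using poly_value_single[OF f, of "[]" 1] single_one[where ?'a = "'b list" and ?'b = 'k]
    by (simp add: zero_list_def)
  have "poly_value A f (Poly_Mapping.single [] c * p) = c \<odot> poly_value A f p"
    if p: "p \<in> carrier (free_algebra X)" for c p
    using poly_value_single_mult[OF f _ p, of "[]"] poly_value_closed[OF f p]
    by (simp add: smult_mult_left)
  then show ?thesis
    unfolding algebra_hom_def
    by (auto intro!: ring_hom_memI poly_value_add[OF f] poly_value_mult[OF f] poly_value_closed[OF f]
        simp: one)
qed

end

lemma poly_value_cong:
  assumes A: "assoc_algebra A" and f: "f \<in> X \<rightarrow> carrier A" and p: "p \<in> carrier (free_algebra X)"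
    and eq: "\<And>x. x \<in> X \<Longrightarrow> f x = g x"
  shows "poly_value A f p = poly_value A g p"
proof -
  interpret A: assoc_algebra A by fact
  have gA: "g \<in> X \<rightarrow> carrier A" using f eq by (metis Pi_I Pi_mem)
  have word: "word_value A f w = word_value A g w" if "set w \<subseteq> X" for w
    using that by (induction w) (auto simp: eq)
  have X: "set w \<subseteq> X" if "w \<in> Poly_Mapping.keys p" for w
    using that p by (auto simp: lists_eq_set)
  have "word_value A g w \<in> carrier A" if "w \<in> Poly_Mapping.keys p" for w
    by (rule A.word_value_closed[OF gA X[OF that]])
  then show ?thesis
    unfolding poly_value_def using X word by (intro A.finsum_cong') auto
qed

lemma algebra_hom_poly_value:
  assumes A: "assoc_algebra A" and B: "assoc_algebra B" and h: "h \<in> algebra_hom A B"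
    and f: "f \<in> X \<rightarrow> carrier A" and p: "p \<in> carrier (free_algebra X)"
  shows "h (poly_value A f p) = poly_value B (h \<circ> f) p"
proof -
  interpret A: assoc_algebra A by fact
  interpret B: assoc_algebra B by fact
  have hf: "h \<circ> f \<in> X \<rightarrow> carrier B" using f algebra_homD(1)[OF h] by (simp add: Pi_iff)
  have word: "h (word_value A f w) = word_value B (h \<circ> f) w" if "set w \<subseteq> X" for w
    using that
  proof (induction w)
    case Nil
    then show ?case by (simp add: algebra_homD(4)[OF h])
  next
    case (Cons x w)
    then have "f x \<in> carrier A" "word_value A f w \<in> carrier A"
      using f A.word_value_closed[OF f] by auto
    then show ?case using Cons by (simp add: algebra_homD(3)[OF h])
  qed
  from p have "Poly_Mapping.keys p \<subseteq> lists X" by simp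
  then show ?thesis
  proof (induction p rule: keys_subset_induct)
    case zero
    then show ?case by (simp add: algebra_hom_zero[OF A B h])
  next
    case (single_add w d p)
    then have w: "set w \<subseteq> X" and p: "p \<in> carrier (free_algebra X)" by (auto simp: lists_eq_set)
    have s: "Poly_Mapping.single w d \<in> carrier (free_algebra X)" using w by (auto simp: lists_eq_set)
    have v: "word_value A f w \<in> carrier A" using f w by auto
    show ?case
      unfolding A.poly_value_add[OF f s p] B.poly_value_add[OF hf s p]
        A.poly_value_single[OF f w] B.poly_value_single[OF hf w]
      using v A.poly_value_closed[OF f p] single_add.IH
      by (simp add: algebra_homD[OF h] word[OF w] del: o_apply)
  qed
qed

lemma algebra_hom_free_diff:
  assumes B: "assoc_algebra B" and h: "h \<in> algebra_hom (free_algebra X) B"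
    and p: "p \<in> carrier (free_algebra X)" and q: "q \<in> carrier (free_algebra X)"
  shows "h (p - q) = h p \<ominus>\<^bsub>B\<^esub> h q"
proof -
  interpret B: assoc_algebra B by fact
  have s: "Poly_Mapping.single [] (-1) * q \<in> carrier (free_algebra X)"
    using assoc_algebra.smult_closed[OF assoc_algebra_free q, of "-1"] by simp
  have "p - q = p + Poly_Mapping.single [] (-1) * q"
    by (rule poly_mapping_eqI) (simp add: lookup_add lookup_minus lookup_scalar_times)
  then have "h (p - q) = h p \<oplus>\<^bsub>B\<^esub> (-1) \<odot>\<^bsub>B\<^esub> h q"
    using algebra_homD(2)[OF h p s] algebra_homD(5)[OF h q, of "-1"] by (simp only: free_algebra_sel)
  then show ?thesis
    using algebra_homD(1)[OF h q] by (simp add: B.smult_minus_one a_minus_def)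
qed

lemma poly_value_deg:
  fixes f :: "'x \<Rightarrow> 'y list \<Rightarrow>\<^sub>0 'k::field"
  assumes f: "f \<in> X \<rightarrow> free_algebra_deg Y 1" and p: "p \<in> free_algebra_deg X n"
  shows "poly_value (free_algebra Y) f p \<in> free_algebra_deg Y n"
proof -
  interpret F: assoc_algebra "free_algebra Y :: ('k, _) module" by (rule assoc_algebra_free)
  have fc: "f \<in> X \<rightarrow> carrier (free_algebra Y)" using f free_algebra_deg_subset by blast
  have word: "word_value (free_algebra Y) f w \<in> free_algebra_deg Y (length w)" if "set w \<subseteq> X" for w
    using that
  proof (induction w)
    case Nil
    then show ?case by (simp add: free_algebra_deg_one)
  next
    case (Cons x w)
    then show ?case using f free_algebra_deg_mult[of "f x" Y 1] by auto
  qed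
  from p have "Poly_Mapping.keys p \<subseteq> {w \<in> lists X. length w = n}" by (simp add: free_algebra_deg_def)
  then show ?thesis
  proof (induction p rule: keys_subset_induct)
    case zero
    then show ?case using F.poly_value_zero[of f] by (simp add: free_algebra_deg_zero)
  next
    case (single_add w d p)
    then have w: "set w \<subseteq> X" "length w = n" and p: "p \<in> carrier (free_algebra X)"
      by (auto simp: lists_eq_set)
    have s: "Poly_Mapping.single w d \<in> carrier (free_algebra X)" using w by (auto simp: lists_eq_set)
    show ?case
      using F.poly_value_add[OF fc s p] single_add.IH free_algebra_deg_scalar[OF word[OF w(1)], of d] w(2)
      by (simp add: F.poly_value_single[OF fc w(1)] free_algebra_deg_add)
  qed
qed


section \<open>Relations of a generating subspace\<close>

locale algebra_subspace = assoc_algebra A for A :: "('k::field, 'a) module" (structure) +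
  fixes W :: "'a set"
  assumes W_subset: "W \<subseteq> carrier A"
    and W_add: "v \<in> W \<Longrightarrow> w \<in> W \<Longrightarrow> v \<oplus> w \<in> W"
    and W_smult: "v \<in> W \<Longrightarrow> c \<odot> v \<in> W"
begin

abbreviation F :: "('k, 'a list \<Rightarrow>\<^sub>0 'k) module" where "F \<equiv> free_algebra W"
abbreviation L :: "('a list \<Rightarrow>\<^sub>0 'k) set" where "L \<equiv> linearity_ideal A W"
abbreviation T :: "('k, ('a list \<Rightarrow>\<^sub>0 'k) set) module" where "T \<equiv> tensor_algebra A W"

lemma linearity_relations_subset: "linearity_relations A W \<subseteq> carrier F"
proof -
  have "letter v \<in> free_algebra_deg W 1" if "v \<in> W" for v
    using that by (rule free_algebra_deg_letter)
  then have "linearity_relations A W \<subseteq> free_algebra_deg W 1"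
    unfolding linearity_relations_def
    by (auto intro!: free_algebra_deg_diff free_algebra_deg_add free_algebra_deg_scalar W_add W_smult)
  then show ?thesis using free_algebra_deg_subset by blast
qed

sublocale F: assoc_algebra F by (rule assoc_algebra_free)

sublocale L: algebra_ideal F L
  unfolding algebra_ideal_def linearity_ideal_def
  using F.genideal_ideal[OF linearity_relations_subset] assoc_algebra_free by blast

lemma T_eq: "T = L.Q"
  by (simp add: tensor_algebra_def)

sublocale T: assoc_algebra T
  unfolding T_eq by (rule L.assoc_algebra_quotient)

text \<open>
  The universal property of the tensor algebra: a linear map on \<open>W\<close> extends to it.
\<close>

lemma linearity_ideal_kills:
  assumes B: "assoc_algebra B" and g: "g \<in> W \<rightarrow> carrier B"
    and add: "\<And>v w. v \<in> W \<Longrightarrow> w \<in> W \<Longrightarrow> g (v \<oplus> w) = g v \<oplus>\<^bsub>B\<^esub> g w"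
    and smult: "\<And>c v. v \<in> W \<Longrightarrow> g (c \<odot> v) = c \<odot>\<^bsub>B\<^esub> g v"
    and x: "x \<in> L"
  shows "poly_value B g x = \<zero>\<^bsub>B\<^esub>"
proof -
  interpret B: assoc_algebra B by fact
  have h: "poly_value B g \<in> algebra_hom F B" by (rule B.poly_value_algebra_hom[OF g])
  note hom = algebra_homD[OF h] algebra_hom_free_diff[OF B h]
  have letter: "poly_value B g (letter v) = g v" "letter v \<in> carrier F" "g v \<in> carrier B"
    if "v \<in> W" for v
    using that g B.poly_value_letter[of g v] free_algebra_deg_letter[OF that] free_algebra_deg_subset
    by blast+
  have "poly_value B g x \<in> {\<zero>\<^bsub>B\<^esub>}"
  proof (rule genideal_hom_subset[OF F.assoc_algebra_axioms B h B.zeroideal linearity_relations_subset])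
    show "x \<in> genideal F (linearity_relations A W)"
      using x by (simp add: linearity_ideal_def)
    fix y assume "y \<in> linearity_relations A W"
    then consider (add) v w where "v \<in> W" "w \<in> W" "y = letter (v \<oplus> w) - (letter v \<oplus>\<^bsub>F\<^esub> letter w)"
      | (smult) c v where "v \<in> W" "y = letter (c \<odot> v) - c \<odot>\<^bsub>F\<^esub> letter v"
      unfolding linearity_relations_def by fastforce
    then have "poly_value B g y = \<zero>\<^bsub>B\<^esub>"
    proof cases
      case add
      show ?thesis
        unfolding add(3)
        using add letter W_add assms(3)
        by (subst hom(6)) (simp_all add: hom(2) a_minus_def B.r_neg del: free_algebra_sel)
    next
      case smult
      show ?thesis
        unfolding smult(2)
        using smult letter W_smult assms(4)
        by (subst hom(6)) (simp_all add: hom(5) a_minus_def B.r_neg del: free_algebra_sel)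
    qed
    then show "poly_value B g y \<in> {\<zero>\<^bsub>B\<^esub>}" by simp
  qed
  then show ?thesis by simp
qed

lemma tensor_eval_coset:
  assumes "p \<in> carrier F"
  shows "tensor_eval A (L +>\<^bsub>F\<^esub> p) = free_eval A p"
  unfolding tensor_eval_def free_eval_eq_poly_value
proof (rule L.induced_hom_coset[OF assoc_algebra_axioms _ _ assms])
  show "poly_value A (\<lambda>x. x) \<in> algebra_hom F A"
    using W_subset by (intro poly_value_algebra_hom) auto
  show "poly_value A (\<lambda>x. x) x = \<zero>" if "x \<in> L" for x
    using that W_subset by (intro linearity_ideal_kills assoc_algebra_axioms) auto
qed

lemma quadratic_relations_eq:
  "quadratic_relations A W =
    {L +>\<^bsub>F\<^esub> r | r. r \<in> free_algebra_deg W 2 \<and> free_eval A r = \<zero>}"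
proof -
  have "r \<in> carrier F" if "r \<in> free_algebra_deg W 2" for r
    using that free_algebra_deg_subset by blast
  then show ?thesis
    unfolding quadratic_relations_def tensor_power_def by (auto simp: tensor_eval_coset)
qed

lemma coset_mult3:
  assumes "u \<in> carrier F" "r \<in> carrier F" "v \<in> carrier F"
  shows "(L +>\<^bsub>F\<^esub> u) \<otimes>\<^bsub>T\<^esub> (L +>\<^bsub>F\<^esub> r) \<otimes>\<^bsub>T\<^esub> (L +>\<^bsub>F\<^esub> v) = L +>\<^bsub>F\<^esub> (u * r * v)"
proof -
  note hom = algebra_homD[OF L.coset_algebra_hom]
  show ?thesis
    using hom(3)[OF F.m_closed[OF assms(1,2)] assms(3)] hom(3)[OF assms(1,2)]
    unfolding T_eq free_algebra_sel(2) by metis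
qed

text \<open>
  The cosets of these products span \<open>W\<^sup>i \<otimes> R \<otimes> W\<^sup>j\<close>. Working with representatives moves
  computations to the free algebra on \<open>W\<close>, whose underlying type is a ring.
\<close>

definition relation_products :: "nat \<Rightarrow> nat \<Rightarrow> ('a list \<Rightarrow>\<^sub>0 'k) set" where
  "relation_products i j = {u * r * v | u r v. u \<in> free_algebra_deg W i \<and>
     r \<in> free_algebra_deg W 2 \<and> free_eval A r = \<zero> \<and> v \<in> free_algebra_deg W j}"

lemma relation_products_subset: "relation_products i j \<subseteq> free_algebra_deg W (i + 2 + j)"
  unfolding relation_products_def using free_algebra_deg_mult by blast

lemma relation_subspace_eq:
  "relation_subspace A W i j = linear_span T ((\<lambda>p. L +>\<^bsub>F\<^esub> p) ` relation_products i j)"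
proof -
  have c: "p \<in> carrier F" if "p \<in> free_algebra_deg W n" for p n
    using that free_algebra_deg_subset by blast
  have "{u \<otimes>\<^bsub>T\<^esub> r \<otimes>\<^bsub>T\<^esub> v | u r v.
        u \<in> tensor_power A W i \<and> r \<in> quadratic_relations A W \<and> v \<in> tensor_power A W j} =
      (\<lambda>p. L +>\<^bsub>F\<^esub> p) ` relation_products i j" (is "?l = ?r")
  proof (intro subset_antisym subsetI)
    fix x assume "x \<in> ?l"
    then obtain u r v where "x = (L +>\<^bsub>F\<^esub> u) \<otimes>\<^bsub>T\<^esub> (L +>\<^bsub>F\<^esub> r) \<otimes>\<^bsub>T\<^esub> (L +>\<^bsub>F\<^esub> v)"
      and *: "u \<in> free_algebra_deg W i" "r \<in> free_algebra_deg W 2" "free_eval A r = \<zero>"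
        "v \<in> free_algebra_deg W j"
      unfolding quadratic_relations_eq tensor_power_def by blast
    then have "x = L +>\<^bsub>F\<^esub> (u * r * v)" by (simp only: coset_mult3 c)
    then show "x \<in> ?r" unfolding relation_products_def using * by blast
  next
    fix x assume "x \<in> ?r"
    then obtain u r v where "x = L +>\<^bsub>F\<^esub> (u * r * v)"
      and *: "u \<in> free_algebra_deg W i" "r \<in> free_algebra_deg W 2" "free_eval A r = \<zero>"
        "v \<in> free_algebra_deg W j"
      unfolding relation_products_def by blast
    then have "x = (L +>\<^bsub>F\<^esub> u) \<otimes>\<^bsub>T\<^esub> (L +>\<^bsub>F\<^esub> r) \<otimes>\<^bsub>T\<^esub> (L +>\<^bsub>F\<^esub> v)" by (simp only: coset_mult3 c)
    then show "x \<in> ?l" unfolding quadratic_relations_eq tensor_power_def using * by blast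
  qed
  then show ?thesis by (simp add: relation_subspace_def)
qed

lemma coset_products_subset: "(\<lambda>p. L +>\<^bsub>F\<^esub> p) ` relation_products i j \<subseteq> carrier T"
  using relation_products_subset free_algebra_deg_subset unfolding T_eq L.carrier_quotient by blast

lemma relation_subspace_product:
  "u \<in> free_algebra_deg W i \<Longrightarrow> r \<in> free_algebra_deg W 2 \<Longrightarrow> free_eval A r = \<zero> \<Longrightarrow>
    v \<in> free_algebra_deg W j \<Longrightarrow> L +>\<^bsub>F\<^esub> (u * r * v) \<in> relation_subspace A W i j"
  unfolding relation_subspace_eq
  by (rule T.linear_span_base[OF coset_products_subset]) (auto simp: relation_products_def)

lemma relation_subspace_add:
  assumes "p \<in> carrier F" "q \<in> carrier F"
    "L +>\<^bsub>F\<^esub> p \<in> relation_subspace A W i j" "L +>\<^bsub>F\<^esub> q \<in> relation_subspace A W i j"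
  shows "L +>\<^bsub>F\<^esub> (p + q) \<in> relation_subspace A W i j"
  using T.linear_span_add[OF coset_products_subset, of "L +>\<^bsub>F\<^esub> p" i j "L +>\<^bsub>F\<^esub> q"]
    algebra_homD(2)[OF L.coset_algebra_hom assms(1,2)] assms(3,4)
  unfolding relation_subspace_eq T_eq free_algebra_sel(5) by metis

lemma relation_subspace_carrier: "relation_subspace A W i j \<subseteq> carrier T"
  unfolding relation_subspace_eq by (rule T.linear_span_subset[OF coset_products_subset])

end

text \<open>
  The component of \<open>q\<close> of degree \<open>i + 2 + j\<close> lies in \<open>V\<^sup>i \<otimes> span \<rho> \<otimes> V\<^sup>j\<close>, where \<open>V\<close> is
  spanned by the letters: the tensor multiplying \<open>\<rho> v\<close> is given by its coefficients \<open>c v\<close>, indexed by the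
  first \<open>i\<close> and the last \<open>j\<close> letters.
\<close>

definition has_relation_at ::
    "('v \<Rightarrow> 'y list \<Rightarrow>\<^sub>0 'k::field) \<Rightarrow> 'v set \<Rightarrow> nat \<Rightarrow> nat \<Rightarrow> ('y list \<Rightarrow>\<^sub>0 'k) \<Rightarrow> bool" where
  "has_relation_at \<rho> I i j q \<longleftrightarrow> (\<exists>c. \<forall>w. length w = i + 2 + j \<longrightarrow>
     Poly_Mapping.lookup q w =
       (\<Sum>v\<in>I. c v (take i w) (drop (i + 2) w) * Poly_Mapping.lookup (\<rho> v) (take 2 (drop i w))))"

locale algebra_coordinates = algebra_subspace A W
  for A :: "('k::field, 'a) module" (structure) and W +
  fixes g :: "'a \<Rightarrow> 'y list \<Rightarrow>\<^sub>0 'k"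
  assumes g_deg: "v \<in> W \<Longrightarrow> g v \<in> free_algebra_deg UNIV 1"
    and g_add: "v \<in> W \<Longrightarrow> w \<in> W \<Longrightarrow> g (v \<oplus> w) = g v + g w"
    and g_smult: "v \<in> W \<Longrightarrow> g (c \<odot> v) = Poly_Mapping.single [] c * g v"
begin

text \<open>
  \<open>\<psi>\<close> is the coordinate homomorphism on representatives, \<open>\<Psi>\<close> the one it induces on the tensor
  algebra of \<open>W\<close>.
\<close>

definition \<psi> :: "('a list \<Rightarrow>\<^sub>0 'k) \<Rightarrow> 'y list \<Rightarrow>\<^sub>0 'k" where
  "\<psi> = poly_value (free_algebra UNIV) g"

definition \<Psi> :: "('a list \<Rightarrow>\<^sub>0 'k) set \<Rightarrow> 'y list \<Rightarrow>\<^sub>0 'k" where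
  "\<Psi> C = the_elem (\<psi> ` C)"

lemma g_carrier: "g \<in> W \<rightarrow> carrier (free_algebra UNIV)"
  by auto

lemma \<psi>_hom: "\<psi> \<in> algebra_hom F (free_algebra UNIV)"
  unfolding \<psi>_def by (rule assoc_algebra.poly_value_algebra_hom[OF assoc_algebra_free g_carrier])

lemma \<psi>_letter: "\<psi> (letter v) = g v"
  unfolding \<psi>_def by (rule assoc_algebra.poly_value_letter[OF assoc_algebra_free]) simp

lemma \<psi>_deg: "p \<in> free_algebra_deg W n \<Longrightarrow> \<psi> p \<in> free_algebra_deg UNIV n"
  unfolding \<psi>_def by (rule poly_value_deg[of _ W]) (use g_deg in blast)+

lemma \<psi>_ops:
  assumes "p \<in> carrier F" "q \<in> carrier F"
  shows "\<psi> (p + q) = \<psi> p + \<psi> q" "\<psi> (p * q) = \<psi> p * \<psi> q" "\<psi> (p - q) = \<psi> p - \<psi> q"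
proof -
  have add: "\<psi> (p + q) = \<psi> p + \<psi> q" if "p \<in> carrier F" "q \<in> carrier F" for p q
    using algebra_homD(2)[OF \<psi>_hom that] by simp
  show "\<psi> (p + q) = \<psi> p + \<psi> q" by (rule add[OF assms])
  show "\<psi> (p * q) = \<psi> p * \<psi> q"
    using algebra_homD(3)[OF \<psi>_hom assms] by simp
  have "p - q \<in> carrier F"
    by (rule free_algebra_closed(3)[OF assms])
  then show "\<psi> (p - q) = \<psi> p - \<psi> q"
    using add[of "p - q" q] assms by simp
qed

lemma \<psi>_kills: "x \<in> L \<Longrightarrow> \<psi> x = \<zero>\<^bsub>free_algebra UNIV\<^esub>"
  unfolding \<psi>_def
  by (rule linearity_ideal_kills[OF assoc_algebra_free g_carrier]) (simp_all add: g_add g_smult)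

lemma \<Psi>_coset: "p \<in> carrier F \<Longrightarrow> \<Psi> (L +>\<^bsub>F\<^esub> p) = \<psi> p"
  unfolding \<Psi>_def by (rule L.induced_hom_coset[OF assoc_algebra_free \<psi>_hom \<psi>_kills])

lemma \<Psi>_hom: "\<Psi> \<in> algebra_hom T (free_algebra UNIV)"
  using L.induced_algebra_hom[OF assoc_algebra_free \<psi>_hom \<psi>_kills] unfolding T_eq \<Psi>_def by blast

text \<open>
  It suffices to bound the image of the relations themselves, because \<open>\<Psi>\<close> is multiplicative and
  homogeneous.
\<close>

lemma \<Psi>_relation_subspace:
  assumes rels: "\<And>r. r \<in> free_algebra_deg W 2 \<Longrightarrow> free_eval A r = \<zero> \<Longrightarrow>
      \<exists>c. \<forall>w. length w = 2 \<longrightarrow> Poly_Mapping.lookup (\<psi> r) w = (\<Sum>v\<in>I. c v * Poly_Mapping.lookup (\<rho> v) w)"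
    and C: "C \<in> relation_subspace A W i j"
  shows "has_relation_at \<rho> I i j (\<Psi> C)"
proof -
  have sub: "(\<lambda>p. L +>\<^bsub>F\<^esub> p) ` relation_products i j \<subseteq> carrier T" by (rule coset_products_subset)
  show ?thesis
    using C unfolding relation_subspace_eq
  proof induction
    case zero
    have "\<Psi> \<zero>\<^bsub>T\<^esub> = 0"
      using algebra_hom_zero[OF T.assoc_algebra_axioms assoc_algebra_free \<Psi>_hom] by simp
    then show ?case
      unfolding has_relation_at_def by (intro exI[of _ "\<lambda>_ _ _. 0"]) simp
  next
    case (add x y a)
    from add.hyps obtain u r v where x: "x = L +>\<^bsub>F\<^esub> (u * r * v)"
      and u: "u \<in> free_algebra_deg W i" and r: "r \<in> free_algebra_deg W 2" "free_eval A r = \<zero>"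
      and v: "v \<in> free_algebra_deg W j"
      unfolding relation_products_def by blast
    have y: "y \<in> carrier T" using add.hyps T.linear_span_subset[OF sub] by blast
    have xc: "x \<in> carrier T" using add.hyps sub by blast
    note dc = subsetD[OF free_algebra_deg_subset]
    have "\<Psi> x = \<psi> (u * r * v)"
      unfolding x by (rule \<Psi>_coset[OF dc[OF free_algebra_deg_mult[OF free_algebra_deg_mult[OF u r(1)] v]]])
    also have "\<dots> = \<psi> u * \<psi> r * \<psi> v"
      using \<psi>_ops(2)[OF dc[OF u] dc[OF r(1)]] \<psi>_ops(2)[OF dc[OF free_algebra_deg_mult[OF u r(1)]] dc[OF v]]
      by simp
    finally have \<Psi>x: "\<Psi> x = \<psi> u * (\<psi> r * \<psi> v)" by (simp add: mult.assoc)
    have \<Psi>xy: "\<Psi> (a \<odot>\<^bsub>T\<^esub> x \<oplus>\<^bsub>T\<^esub> y) = Poly_Mapping.single [] a * \<Psi> x + \<Psi> y"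
      using algebra_homD(2,5)[OF \<Psi>_hom] xc y by simp
    from rels[OF r] obtain c where c: "\<And>w. length w = 2 \<Longrightarrow>
        Poly_Mapping.lookup (\<psi> r) w = (\<Sum>v\<in>I. c v * Poly_Mapping.lookup (\<rho> v) w)" by blast
    from add.IH obtain d where d: "\<And>w. length w = i + 2 + j \<Longrightarrow> Poly_Mapping.lookup (\<Psi> y) w =
       (\<Sum>v\<in>I. d v (take i w) (drop (i + 2) w) * Poly_Mapping.lookup (\<rho> v) (take 2 (drop i w)))"
      unfolding has_relation_at_def by blast
    show ?case
      unfolding has_relation_at_def \<Psi>xy
    proof (rule exI, intro allI impI)
      fix w :: "'y list" assume w: "length w = i + 2 + j"
      have "Poly_Mapping.lookup (\<Psi> x) w = Poly_Mapping.lookup (\<psi> u) (take i w) *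
          (Poly_Mapping.lookup (\<psi> r) (take 2 (drop i w)) * Poly_Mapping.lookup (\<psi> v) (drop (i + 2) w))"
        unfolding \<Psi>x using w
        by (simp add: lookup_times_deg[OF \<psi>_deg[OF u]] lookup_times_deg[OF \<psi>_deg[OF r(1)]] add.commute)
      also have "Poly_Mapping.lookup (\<psi> r) (take 2 (drop i w)) =
          (\<Sum>v\<in>I. c v * Poly_Mapping.lookup (\<rho> v) (take 2 (drop i w)))"
        using w by (intro c) simp
      finally show "Poly_Mapping.lookup (Poly_Mapping.single [] a * \<Psi> x + \<Psi> y) w =
          (\<Sum>k\<in>I. (\<lambda>k s t. a * Poly_Mapping.lookup (\<psi> u) s * c k * Poly_Mapping.lookup (\<psi> v) t + d k s t)
             k (take i w) (drop (i + 2) w) * Poly_Mapping.lookup (\<rho> k) (take 2 (drop i w)))"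
        by (simp add: lookup_add lookup_scalar_times d[OF w] sum_distrib_left sum_distrib_right
            distrib_right sum.distrib algebra_simps)
    qed
  qed
qed

end


section \<open>Path polynomials\<close>

text \<open>
  The elementary symmetric functions of noncommuting letters, each product taken in the order of
  the word: up to sign these are the coefficients of \<open>(t - e\<^sub>1) \<cdots> (t - e\<^sub>k)\<close>.
\<close>

fun elem_sym :: "nat \<Rightarrow> 'e list \<Rightarrow> 'e list \<Rightarrow>\<^sub>0 'k::field" where
  "elem_sym 0 es = 1"
| "elem_sym (Suc j) [] = 0"
| "elem_sym (Suc j) (e # es) = elem_sym (Suc j) es + letter e * elem_sym j es"

lemma elem_sym_deg: "set es \<subseteq> X \<Longrightarrow> elem_sym j es \<in> free_algebra_deg X j"
proof (induction j es rule: elem_sym.induct)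
  case (3 j e es)
  then show ?case
    using free_algebra_deg_mult[OF free_algebra_deg_letter[of e X] 3(2)]
    by (auto intro: free_algebra_deg_add)
qed (simp_all add: free_algebra_deg_one free_algebra_deg_zero)

lemma elem_sym_eq_zero: "length es < j \<Longrightarrow> elem_sym j es = 0"
  by (induction j es rule: elem_sym.induct) auto

lemma lookup_const_times:
  "Poly_Mapping.lookup (Poly_Mapping.single 0 c * p) m = c * Poly_Mapping.lookup p m"
  for p :: "nat \<Rightarrow>\<^sub>0 'r::ring_1"
  by (simp add: lookup_mult lookup_single when_mult)

lemma lookup_var_times:
  "Poly_Mapping.lookup (Poly_Mapping.single (Suc 0) 1 * p) m =
    (case m of 0 \<Rightarrow> 0 | Suc n \<Rightarrow> Poly_Mapping.lookup p n)"
  for p :: "nat \<Rightarrow>\<^sub>0 'r::ring_1"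
  by (cases m) (simp_all add: lookup_mult lookup_single when_mult)

lemma lookup_path_poly_Cons:
  fixes es :: "'e list"
  shows "Poly_Mapping.lookup (path_poly (e # es) :: nat \<Rightarrow>\<^sub>0 ('e list \<Rightarrow>\<^sub>0 'k::field)) m =
    (case m of 0 \<Rightarrow> 0 | Suc n \<Rightarrow> Poly_Mapping.lookup (path_poly es) n)
     - letter e * Poly_Mapping.lookup (path_poly es) m"
proof -
  have "(path_poly (e # es) :: nat \<Rightarrow>\<^sub>0 ('e list \<Rightarrow>\<^sub>0 'k)) =
      (Poly_Mapping.single (Suc 0) 1 - Poly_Mapping.single 0 (letter e)) * path_poly es"
    by (simp add: path_poly_def)
  then show ?thesis
    by (simp add: left_diff_distrib lookup_minus lookup_const_times lookup_var_times)
qed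

lemma lookup_path_poly:
  fixes es :: "'e list"
  shows "Poly_Mapping.lookup (path_poly es) m =
    (if m \<le> length es then (-1) ^ (length es - m) * elem_sym (length es - m) es
     else (0 :: 'e list \<Rightarrow>\<^sub>0 'k::field))"
proof (induction es arbitrary: m)
  case Nil
  then show ?case by (simp add: path_poly_def lookup_one when_def)
next
  case (Cons e es)
  have comm: "letter e * (- 1) ^ n = (- 1) ^ n * (letter e :: 'e list \<Rightarrow>\<^sub>0 'k)" for n
    by (cases "even n") simp_all
  show ?case
  proof (cases "m \<le> length es")
    case False
    then show ?thesis
      unfolding lookup_path_poly_Cons Cons.IH by (auto split: nat.split)
  next
    case True
    then obtain j where j: "length es = m + j" using le_Suc_ex by blast
    show ?thesis
    proof (cases m)
      case 0
      then show ?thesis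
        unfolding lookup_path_poly_Cons Cons.IH using j
        by (simp add: elem_sym_eq_zero distrib_left mult.assoc[symmetric] comm)
    next
      case (Suc n)
      then have "length es - n = Suc j" using j by simp
      then show ?thesis
        unfolding lookup_path_poly_Cons Cons.IH using j Suc
        by (simp add: distrib_left mult.assoc[symmetric] comm)
    qed
  qed
qed

text \<open>
  Here \<open>j\<close> is the length of the paths minus the exponent of \<open>t\<close>. For an exponent beyond the length the
  relation is \<open>0\<close>, which is covered by \<open>j = 0\<close>.
\<close>

lemma path_relation_cases:
  assumes "x \<in> path_relations G"
  obtains es fs u v j where "length es = length fs" "pre_digraph.awalk G u es v"
    "pre_digraph.awalk G u fs v" "x = (-1) ^ j * (elem_sym j es - elem_sym j fs)"
proof -
  from assms obtain es fs m u v where *: "length es = length fs" "pre_digraph.awalk G u es v"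
    "pre_digraph.awalk G u fs v" and x: "x = Poly_Mapping.lookup (path_poly es - path_poly fs) m"
    unfolding path_relations_def by blast
  have "\<exists>j. x = (-1) ^ j * (elem_sym j es - elem_sym j fs)"
  proof (cases "m \<le> length es")
    case True
    then show ?thesis unfolding x using *(1)
      by (intro exI[of _ "length es - m"]) (simp add: lookup_minus lookup_path_poly right_diff_distrib)
  next
    case False
    then show ?thesis unfolding x using *(1)
      by (intro exI[of _ 0]) (simp add: lookup_minus lookup_path_poly)
  qed
  then show ?thesis using that * by blast
qed

lemma power_minus_one_in_deg: "(-1) ^ n \<in> free_algebra_deg X 0"
  by (cases "even n") (simp_all add: free_algebra_deg_one
      free_algebra_deg_diff[OF free_algebra_deg_zero free_algebra_deg_one, simplified])

lemma path_relations_subset: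
  "(path_relations G :: ('e list \<Rightarrow>\<^sub>0 'k::field) set) \<subseteq> carrier (free_algebra (arcs G))"
proof
  fix x :: "'e list \<Rightarrow>\<^sub>0 'k" assume "x \<in> path_relations G"
  then obtain es fs u v j where w: "pre_digraph.awalk G u es v" "pre_digraph.awalk G u fs v"
    and x: "x = (-1) ^ j * (elem_sym j es - elem_sym j fs)"
    by (rule path_relation_cases)
  have "set es \<subseteq> arcs G" "set fs \<subseteq> arcs G" using w by (simp_all add: pre_digraph.awalk_def)
  then have "x \<in> free_algebra_deg (arcs G) (0 + j)"
    unfolding x by (intro free_algebra_deg_mult power_minus_one_in_deg free_algebra_deg_diff elem_sym_deg)
  then show "x \<in> carrier (free_algebra (arcs G))" using free_algebra_deg_subset by blast
qed

lemma algebra_ideal_graph_ideal: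
  "algebra_ideal (free_algebra (arcs G)) (graph_ideal G :: ('e list \<Rightarrow>\<^sub>0 'k::field) set)"
proof -
  interpret F: assoc_algebra "free_algebra (arcs G) :: ('k, _) module" by (rule assoc_algebra_free)
  show ?thesis
    unfolding algebra_ideal_def graph_ideal_def
    using F.genideal_ideal[OF path_relations_subset] F.assoc_algebra_axioms by blast
qed

lemma elem_sym_diff_in_graph_ideal:
  assumes "length es = length fs" "pre_digraph.awalk G u es v" "pre_digraph.awalk G u fs v"
    and "j \<le> length es"
  shows "elem_sym j es - elem_sym j fs \<in> (graph_ideal G :: ('e list \<Rightarrow>\<^sub>0 'k::field) set)"
proof -
  interpret I: algebra_ideal "free_algebra (arcs G)" "graph_ideal G :: ('e list \<Rightarrow>\<^sub>0 'k) set"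
    by (rule algebra_ideal_graph_ideal)
  let ?x = "Poly_Mapping.lookup (path_poly es - path_poly fs) (length es - j) :: 'e list \<Rightarrow>\<^sub>0 'k"
  have "?x \<in> path_relations G" unfolding path_relations_def using assms by blast
  then have "?x \<in> graph_ideal G"
    unfolding graph_ideal_def using I.genideal_self[OF path_relations_subset] by blast
  then have "(-1) ^ j * ?x \<in> graph_ideal G"
    using I.I_l_closed[of ?x "(-1) ^ j"] free_algebra_deg_subset[of "arcs G" 0] power_minus_one_in_deg
    by auto
  moreover have "?x = (-1) ^ j * (elem_sym j es - elem_sym j fs)"
    using assms by (simp add: lookup_minus lookup_path_poly right_diff_distrib)
  ultimately show ?thesis by (simp add: mult.assoc[symmetric] power_add[symmetric])
qed

lemma graph_algebra_subspace:
  "algebra_subspace (graph_algebra G :: ('k::field, ('e list \<Rightarrow>\<^sub>0 'k) set) module) (graph_algebra_deg G 1)"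
proof -
  interpret I: algebra_ideal "free_algebra (arcs G)" "graph_ideal G :: ('e list \<Rightarrow>\<^sub>0 'k) set"
    by (rule algebra_ideal_graph_ideal)
  interpret A: assoc_algebra "graph_algebra G :: ('k, ('e list \<Rightarrow>\<^sub>0 'k) set) module"
    unfolding graph_algebra_def by (rule I.assoc_algebra_quotient)
  note c = subsetD[OF free_algebra_deg_subset[of "arcs G" 1]]
  show ?thesis
  proof
    show "graph_algebra_deg G 1 \<subseteq> carrier (graph_algebra G :: ('k, ('e list \<Rightarrow>\<^sub>0 'k) set) module)"
      unfolding graph_algebra_def graph_algebra_deg_def I.carrier_quotient using c by blast
    fix v w :: "('e list \<Rightarrow>\<^sub>0 'k) set" and k :: 'k
    assume v: "v \<in> graph_algebra_deg G 1"
    then obtain p where p: "v = graph_ideal G +>\<^bsub>free_algebra (arcs G) :: ('k, _) module\<^esub> p"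
      "p \<in> free_algebra_deg (arcs G) 1"
      unfolding graph_algebra_deg_def by blast
    show "k \<odot>\<^bsub>graph_algebra G\<^esub> v \<in> graph_algebra_deg G 1"
      unfolding graph_algebra_def p(1) I.quotient_smult[OF c[OF p(2)]] graph_algebra_deg_def
        free_algebra_sel
      using free_algebra_deg_scalar[OF p(2)] by blast
    assume "w \<in> graph_algebra_deg G 1"
    then obtain q where q: "w = graph_ideal G +>\<^bsub>free_algebra (arcs G) :: ('k, _) module\<^esub> q"
      "q \<in> free_algebra_deg (arcs G) 1"
      unfolding graph_algebra_deg_def by blast
    show "v \<oplus>\<^bsub>graph_algebra G\<^esub> w \<in> graph_algebra_deg G 1"
      unfolding graph_algebra_def p(1) q(1) I.quotient_ops(1)[OF c[OF p(2)] c[OF q(2)]]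
        graph_algebra_deg_def free_algebra_sel
      using free_algebra_deg_add[OF p(2) q(2)] by blast
  qed
qed


section \<open>Ideals that bound the quadratic relations\<close>

text \<open>
  The ideal of noncommutative polynomials that agree up to degree 2 with a combination of the forms
  \<open>\<rho> v\<close>. For quadratic \<open>\<rho> v\<close> this is a two-sided ideal containing everything of degree at least
  3; modulo it, degrees 0 and 1 are untouched and degree 2 is divided by the span of the \<open>\<rho> v\<close>. It
  thus separates exactly what is needed to find the relations of degree at most 2.
\<close>

definition low_degree_ideal :: "('v \<Rightarrow> 'y list \<Rightarrow>\<^sub>0 'k::field) \<Rightarrow> 'v set \<Rightarrow> ('y list \<Rightarrow>\<^sub>0 'k) set" where
  "low_degree_ideal \<rho> I = {q. \<exists>c. \<forall>w. length w \<le> 2 \<longrightarrow>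
     Poly_Mapping.lookup q w = (\<Sum>v\<in>I. c v * Poly_Mapping.lookup (\<rho> v) w)}"

lemma low_degree_ideal_add:
  "p \<in> low_degree_ideal \<rho> I \<Longrightarrow> q \<in> low_degree_ideal \<rho> I \<Longrightarrow> p + q \<in> low_degree_ideal \<rho> I"
  unfolding low_degree_ideal_def
proof clarify
  fix c d
  assume "\<forall>w. length w \<le> 2 \<longrightarrow> Poly_Mapping.lookup p w = (\<Sum>v\<in>I. c v * Poly_Mapping.lookup (\<rho> v) w)"
    "\<forall>w. length w \<le> 2 \<longrightarrow> Poly_Mapping.lookup q w = (\<Sum>v\<in>I. d v * Poly_Mapping.lookup (\<rho> v) w)"
  then show "\<exists>c. \<forall>w. length w \<le> 2 \<longrightarrow>
      Poly_Mapping.lookup (p + q) w = (\<Sum>v\<in>I. c v * Poly_Mapping.lookup (\<rho> v) w)"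
    by (intro exI[of _ "\<lambda>v. c v + d v"]) (simp add: lookup_add sum.distrib distrib_right)
qed

lemma low_degree_ideal_mult:
  assumes \<rho>: "\<And>v. v \<in> I \<Longrightarrow> \<rho> v \<in> free_algebra_deg UNIV 2" and p: "p \<in> low_degree_ideal \<rho> I"
  shows "s * p \<in> low_degree_ideal \<rho> I" "p * s \<in> low_degree_ideal \<rho> I"
proof -
  from p obtain c where c: "\<And>w. length w \<le> 2 \<Longrightarrow>
      Poly_Mapping.lookup p w = (\<Sum>v\<in>I. c v * Poly_Mapping.lookup (\<rho> v) w)"
    unfolding low_degree_ideal_def by blast
  have zero: "Poly_Mapping.lookup p w = 0" if "length w < 2" for w
  proof -
    have "Poly_Mapping.lookup (\<rho> v) w = 0" if "v \<in> I" for v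
      using \<rho>[OF that] \<open>length w < 2\<close> unfolding free_algebra_deg_iff by force
    then show ?thesis using that c[of w] by simp
  qed
  have l: "Poly_Mapping.lookup (s * p) w = Poly_Mapping.lookup s [] * Poly_Mapping.lookup p w"
    and r: "Poly_Mapping.lookup (p * s) w = Poly_Mapping.lookup p w * Poly_Mapping.lookup s []"
    if w: "length w \<le> 2" for w
  proof -
    have "(\<Sum>n\<le>length w. Poly_Mapping.lookup s (take n w) * Poly_Mapping.lookup p (drop n w)) =
        (\<Sum>n\<in>{0}. Poly_Mapping.lookup s (take n w) * Poly_Mapping.lookup p (drop n w))"
      using w by (intro sum.mono_neutral_right) (auto intro: zero)
    then show "Poly_Mapping.lookup (s * p) w = Poly_Mapping.lookup s [] * Poly_Mapping.lookup p w"
      by (simp add: lookup_times_words)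
    have "(\<Sum>n\<le>length w. Poly_Mapping.lookup p (take n w) * Poly_Mapping.lookup s (drop n w)) =
        (\<Sum>n\<in>{length w}. Poly_Mapping.lookup p (take n w) * Poly_Mapping.lookup s (drop n w))"
      using w by (intro sum.mono_neutral_right) (auto intro: zero)
    then show "Poly_Mapping.lookup (p * s) w = Poly_Mapping.lookup p w * Poly_Mapping.lookup s []"
      by (simp add: lookup_times_words)
  qed
  show "s * p \<in> low_degree_ideal \<rho> I" "p * s \<in> low_degree_ideal \<rho> I"
    unfolding low_degree_ideal_def
    by (auto intro!: exI[of _ "\<lambda>v. Poly_Mapping.lookup s [] * c v"]
        simp: l r c sum_distrib_left algebra_simps)
qed

lemma low_degree_ideal_uminus: "p \<in> low_degree_ideal \<rho> I \<Longrightarrow> - p \<in> low_degree_ideal \<rho> I"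
  unfolding low_degree_ideal_def
proof clarify
  fix c
  assume "\<forall>w. length w \<le> 2 \<longrightarrow> Poly_Mapping.lookup p w = (\<Sum>v\<in>I. c v * Poly_Mapping.lookup (\<rho> v) w)"
  then show "\<exists>c. \<forall>w. length w \<le> 2 \<longrightarrow>
      Poly_Mapping.lookup (- p) w = (\<Sum>v\<in>I. c v * Poly_Mapping.lookup (\<rho> v) w)"
    by (intro exI[of _ "\<lambda>v. - c v"]) (simp add: sum_negf)
qed

lemma low_degree_ideal_high:
  assumes "p \<in> free_algebra_deg UNIV n" "n > 2"
  shows "p \<in> low_degree_ideal \<rho> I"
proof -
  have "Poly_Mapping.lookup p w = 0" if "length w \<le> 2" for w
    using assms that unfolding free_algebra_deg_iff by force
  then show ?thesis unfolding low_degree_ideal_def by (auto intro!: exI[of _ "\<lambda>_. 0"])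
qed

lemma low_degree_ideal_zero: "0 \<in> low_degree_ideal \<rho> I"
  using low_degree_ideal_high[of 0 3] by (simp add: free_algebra_deg_zero)

lemma low_degree_ideal_generator:
  assumes "finite I" "v \<in> I"
  shows "\<rho> v \<in> low_degree_ideal \<rho> I"
proof -
  have "(\<Sum>u\<in>I. (if u = v then 1 else 0) * Poly_Mapping.lookup (\<rho> u) w) = Poly_Mapping.lookup (\<rho> v) w" for w
    using assms by (simp add: if_distrib[of "\<lambda>x. x * _"] cong: if_cong)
  then show ?thesis
    unfolding low_degree_ideal_def by (auto intro!: exI[of _ "\<lambda>u. if u = v then 1 else 0"])
qed

lemma ideal_low_degree_ideal:
  fixes \<rho> :: "'v \<Rightarrow> 'y list \<Rightarrow>\<^sub>0 'k::field"
  assumes \<rho>: "\<And>v. v \<in> I \<Longrightarrow> \<rho> v \<in> free_algebra_deg UNIV 2"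
  shows "ideal (low_degree_ideal \<rho> I) (free_algebra UNIV)"
proof -
  interpret F: assoc_algebra "free_algebra UNIV :: ('k, 'y list \<Rightarrow>\<^sub>0 'k) module"
    by (rule assoc_algebra_free)
  have minus: "\<ominus>\<^bsub>free_algebra UNIV\<^esub> p = - p" for p :: "'y list \<Rightarrow>\<^sub>0 'k"
    by (rule F.minus_equality) auto
  show ?thesis
  proof (rule idealI)
    show "subgroup (low_degree_ideal \<rho> I) (add_monoid (free_algebra UNIV))"
      by (rule F.add.subgroupI)
        (use low_degree_ideal_zero[of \<rho> I] in \<open>auto simp: minus low_degree_ideal_add
          low_degree_ideal_uminus simp flip: a_inv_def\<close>)
  qed (use low_degree_ideal_mult[of I \<rho>] \<rho> in \<open>auto simp: F.ring_axioms\<close>)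
qed

lemma low_degree_ideal_linear:
  assumes "p \<in> low_degree_ideal \<rho> I" "p \<in> free_algebra_deg UNIV 1"
    and "\<And>v. v \<in> I \<Longrightarrow> \<rho> v \<in> free_algebra_deg UNIV 2"
  shows "p = 0"
proof (rule poly_mapping_eqI)
  fix w
  from assms(1) obtain c where c: "\<And>w. length w \<le> 2 \<Longrightarrow>
      Poly_Mapping.lookup p w = (\<Sum>v\<in>I. c v * Poly_Mapping.lookup (\<rho> v) w)"
    unfolding low_degree_ideal_def by blast
  show "Poly_Mapping.lookup p w = Poly_Mapping.lookup 0 w"
  proof (cases "length w = 1")
    case True
    have "Poly_Mapping.lookup (\<rho> v) w = 0" if "v \<in> I" for v
      using assms(3)[OF that] True unfolding free_algebra_deg_iff by force
    then show ?thesis using c[of w] True by simp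
  next
    case False
    then show ?thesis using assms(2) unfolding free_algebra_deg_iff by auto
  qed
qed


section \<open>Coordinates on the algebra of \<open>H\<close>\<close>

text \<open>
  The linear form assigned to a vertex. Only \<open>* \<mapsto> 0\<close> is forced. Sending \<open>p\<close> to \<open>0\<close> as well loses
  information about \<open>W\<close>, but the images of the five relations still do not overlap, and the element
  of \<open>Y \<inter> (X + Z)\<close> keeps a term \<open>a x w\<^sub>1 q\<close>.
\<close>

definition coord :: "H_vertex \<Rightarrow> H_vertex list \<Rightarrow>\<^sub>0 'k::field" where
  "coord v = (if v = v_star \<or> v = v_p then 0 else letter v)"

definition arc_coord :: "H_vertex \<times> H_vertex \<Rightarrow> H_vertex list \<Rightarrow>\<^sub>0 'k::field" where
  "arc_coord e = coord (fst e) - coord (snd e)"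

definition arc_hom :: "((H_vertex \<times> H_vertex) list \<Rightarrow>\<^sub>0 'k::field) \<Rightarrow> H_vertex list \<Rightarrow>\<^sub>0 'k" where
  "arc_hom = poly_value (free_algebra UNIV) arc_coord"

definition rel_vertices :: "H_vertex set" where
  "rel_vertices = {v_a, v_x, v_y, v_w2, v_w3}"

text \<open>
  The five relations in these coordinates. Each is attached to the vertex where its two paths
  start; those of \<open>w\<^sub>2\<close> and \<open>w\<^sub>3\<close> are written with the opposite sign.
\<close>

definition reduced_rel :: "H_vertex \<Rightarrow> H_vertex list \<Rightarrow>\<^sub>0 'k::field" where
  "reduced_rel v = (case v of
      v_a \<Rightarrow> (coord v_a - coord v_x) * coord v_x + (coord v_x - coord v_w1) * coord v_w1
           - (coord v_a - coord v_y) * coord v_y - (coord v_y - coord v_w1) * coord v_w1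
    | v_x \<Rightarrow> (coord v_x - coord v_w1) * coord v_w1 - (coord v_x - coord v_w2) * coord v_w2
    | v_y \<Rightarrow> (coord v_y - coord v_w1) * coord v_w1 - (coord v_y - coord v_w3) * coord v_w3
    | v_w2 \<Rightarrow> (coord v_w2 - coord v_q) * coord v_q
    | v_w3 \<Rightarrow> (coord v_w3 - coord v_q) * coord v_q
    | _ \<Rightarrow> 0)"

text \<open>
  The second elementary symmetric function of a path from \<open>v\<close> down to \<open>*\<close>. Adding its edges to
  those of a path from \<open>u\<close> to \<open>v\<close> shows what the second symmetric function of the latter has to
  be modulo the relations: \<open>potential u - potential v - (u - v) v\<close>.
\<close>

definition potential :: "H_vertex \<Rightarrow> H_vertex list \<Rightarrow>\<^sub>0 'k::field" where
  "potential v = (case v of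
      v_a \<Rightarrow> (coord v_a - coord v_x) * coord v_x + (coord v_x - coord v_w1) * coord v_w1
    | v_x \<Rightarrow> (coord v_x - coord v_w1) * coord v_w1
    | v_y \<Rightarrow> (coord v_y - coord v_w1) * coord v_w1
    | _ \<Rightarrow> 0)"

abbreviation rel_ideal :: "(H_vertex list \<Rightarrow>\<^sub>0 'k::field) set" where
  "rel_ideal \<equiv> low_degree_ideal reduced_rel rel_vertices"

lemma coord_deg: "coord v \<in> free_algebra_deg UNIV 1"
  by (simp add: coord_def free_algebra_deg_zero free_algebra_deg_letter[of v UNIV, simplified])

lemma coord_mult_deg: "(coord u - coord v) * coord w \<in> free_algebra_deg UNIV 2"
  using free_algebra_deg_mult[OF free_algebra_deg_diff[OF coord_deg coord_deg] coord_deg, of u v w]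
  by (simp add: numeral_2_eq_2)

lemma reduced_rel_deg: "reduced_rel v \<in> free_algebra_deg UNIV 2"
  by (cases v) (simp_all add: reduced_rel_def free_algebra_deg_zero coord_mult_deg
      free_algebra_deg_diff free_algebra_deg_add)

lemma rel_ideal_ideal: "ideal rel_ideal (free_algebra UNIV :: ('k::field, _) module)"
  by (rule ideal_low_degree_ideal) (rule reduced_rel_deg)

lemma arc_hom_hom:
  "arc_hom \<in> algebra_hom (free_algebra UNIV) (free_algebra UNIV :: ('k::field, _) module)"
  unfolding arc_hom_def
  by (rule assoc_algebra.poly_value_algebra_hom[OF assoc_algebra_free]) auto

lemma arc_hom_simps [simp]:
  fixes p q :: "_ \<Rightarrow>\<^sub>0 'k::field"
  shows "arc_hom (p + q) = arc_hom p + arc_hom q" "arc_hom (p * q) = arc_hom p * arc_hom q"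
  "arc_hom (p - q) = arc_hom p - arc_hom q" "arc_hom 1 = (1 :: _ \<Rightarrow>\<^sub>0 'k)" "arc_hom 0 = (0 :: _ \<Rightarrow>\<^sub>0 'k)"
  "arc_hom (letter e) = (arc_coord e :: _ \<Rightarrow>\<^sub>0 'k)"
proof -
  note hom = algebra_homD[OF arc_hom_hom, simplified]
  have add: "arc_hom (p + q) = arc_hom p + arc_hom q" for p q :: "_ \<Rightarrow>\<^sub>0 'k" by (rule hom)
  show "arc_hom (p + q) = arc_hom p + arc_hom q" by (rule add)
  show "arc_hom (p * q) = arc_hom p * arc_hom q" "arc_hom 1 = (1 :: _ \<Rightarrow>\<^sub>0 'k)" by (rule hom)+
  show "arc_hom (p - q) = arc_hom p - arc_hom q" using add[of "p - q" q] by simp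
  show "arc_hom 0 = (0 :: _ \<Rightarrow>\<^sub>0 'k)" using add[of 0 0] by simp
  show "arc_hom (letter e) = (arc_coord e :: _ \<Rightarrow>\<^sub>0 'k)"
    unfolding arc_hom_def
    by (rule assoc_algebra.poly_value_letter[OF assoc_algebra_free]) auto
qed

lemma arc_hom_deg:
  "p \<in> free_algebra_deg X n \<Longrightarrow> arc_hom p \<in> free_algebra_deg UNIV n"
  unfolding arc_hom_def
  by (rule poly_value_deg[of _ X])
    (unfold arc_coord_def, use free_algebra_deg_diff[OF coord_deg coord_deg] in blast)+

text \<open>
  The formula for a path consisting of one edge, whose second symmetric function is \<open>0\<close>. For the
  edges that the paths behind \<open>potential\<close> use, and for those leading to \<open>p\<close> or \<open>*\<close>, it holds
  exactly; each of the remaining five produces one of the five relations, up to sign.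
\<close>

lemma potential_arc:
  assumes "(u, v) \<in> arcs graph_H"
  shows "potential u - potential v - (coord u - coord v) * coord v \<in> rel_ideal"
proof -
  have gen: "reduced_rel v \<in> rel_ideal" "- reduced_rel v \<in> rel_ideal" if "v \<in> rel_vertices" for v
    using that low_degree_ideal_generator low_degree_ideal_uminus
    by (metis rel_vertices_def finite.emptyI finite.insertI)+
  have "potential u - potential v - (coord u - coord v) * coord v \<in>
      {0, reduced_rel v_a, reduced_rel v_x, reduced_rel v_y, - reduced_rel v_w2, - reduced_rel v_w3}"
    using assms unfolding graph_H_def
    by (auto simp: potential_def reduced_rel_def coord_def algebra_simps)
  moreover have "{0, reduced_rel v_a, reduced_rel v_x, reduced_rel v_y, - reduced_rel v_w2, - reduced_rel v_w3} \<subseteq> rel_ideal"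
  proof -
    have "v_a \<in> rel_vertices" "v_x \<in> rel_vertices" "v_y \<in> rel_vertices"
      "v_w2 \<in> rel_vertices" "v_w3 \<in> rel_vertices"
      by (simp_all add: rel_vertices_def)
    then show ?thesis by (simp add: gen low_degree_ideal_zero)
  qed
  ultimately show ?thesis by blast
qed

text \<open>
  Since the first two symmetric functions of a walk depend, modulo the relations, on its end points only,
  there is no need to enumerate pairs of paths: the edges are enough.
\<close>

lemma elem_sym_walk:
  assumes "pre_digraph.cas graph_H u es z" "set es \<subseteq> arcs graph_H"
  shows "arc_hom (elem_sym 1 es) = (coord u - coord z :: _ \<Rightarrow>\<^sub>0 'k::field) \<and>
    arc_hom (elem_sym 2 es) - (potential u - potential z - (coord u - coord z) * coord z)
      \<in> (rel_ideal :: (_ \<Rightarrow>\<^sub>0 'k) set)"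
  using assms
proof (induction es arbitrary: u)
  case Nil
  then show ?case by (simp add: pre_digraph.cas.simps low_degree_ideal_zero numeral_2_eq_2)
next
  case (Cons e es)
  obtain v where e: "e = (u, v)" "(u, v) \<in> arcs graph_H" and cas: "pre_digraph.cas graph_H v es z"
    using Cons.prems by (cases e) (auto simp: pre_digraph.cas.simps graph_H_def)
  have "set es \<subseteq> arcs graph_H" using Cons.prems(2) by simp
  note IH = conjunct1[OF Cons.IH[OF cas this]] conjunct2[OF Cons.IH[OF cas this]]
  have one: "arc_hom (elem_sym 1 (e # es)) = (coord u - coord z :: _ \<Rightarrow>\<^sub>0 'k)"
    using IH(1) by (simp add: e arc_coord_def)
  have two: "arc_hom (elem_sym 2 (e # es)) =
      (arc_hom (elem_sym 2 es) + (coord u - coord v) * (coord v - coord z) :: _ \<Rightarrow>\<^sub>0 'k)"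
    using IH(1) by (simp add: e arc_coord_def numeral_2_eq_2)
  have "arc_hom (elem_sym 2 (e # es)) - (potential u - potential z - (coord u - coord z) * coord z) =
    (arc_hom (elem_sym 2 es) - (potential v - potential z - (coord v - coord z) * coord z)) +
    - (potential u - potential v - (coord u - coord v) * coord v :: _ \<Rightarrow>\<^sub>0 'k)"
    unfolding two by (simp add: algebra_simps)
  also have "\<dots> \<in> rel_ideal"
    by (intro low_degree_ideal_add low_degree_ideal_uminus IH(2) potential_arc e(2))
  finally show ?case using one by blast
qed

text \<open>
  The upper bound on the relations of \<open>A(H)\<close> in degree at most 2. Of the coefficients of a path
  polynomial only the first and the second symmetric function matter, the higher ones being of degree at
  least 3.
\<close>

lemma arc_hom_graph_ideal:
  assumes "p \<in> graph_ideal graph_H"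
  shows "arc_hom p \<in> (rel_ideal :: (_ \<Rightarrow>\<^sub>0 'k::field) set)"
proof (rule genideal_hom_subset[OF assoc_algebra_free assoc_algebra_free _ rel_ideal_ideal
      path_relations_subset _ assms[unfolded graph_ideal_def]])
  show "arc_hom \<in> algebra_hom (free_algebra (arcs graph_H)) (free_algebra UNIV :: ('k, _) module)"
    unfolding arc_hom_def
    by (rule assoc_algebra.poly_value_algebra_hom[OF assoc_algebra_free]) auto
  fix x :: "_ \<Rightarrow>\<^sub>0 'k" assume "x \<in> path_relations graph_H"
  then obtain es fs u v j where walks: "pre_digraph.awalk graph_H u es v" "pre_digraph.awalk graph_H u fs v"
    and x: "x = (-1) ^ j * (elem_sym j es - elem_sym j fs)"
    by (rule path_relation_cases)
  have w: "pre_digraph.cas graph_H u es v" "set es \<subseteq> arcs graph_H"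
     "pre_digraph.cas graph_H u fs v" "set fs \<subseteq> arcs graph_H"
    using walks by (simp_all add: pre_digraph.awalk_def)
  have "arc_hom (elem_sym j es) - arc_hom (elem_sym j fs) \<in> (rel_ideal :: (_ \<Rightarrow>\<^sub>0 'k) set)"
  proof -
    consider "j = 0" | "j = 1" | "j = 2" | "j > 2" by linarith
    then show ?thesis
    proof cases
      case 3
      show ?thesis
        using low_degree_ideal_add[OF conjunct2[OF elem_sym_walk[OF w(1,2)]]
            low_degree_ideal_uminus[OF conjunct2[OF elem_sym_walk[OF w(3,4)]]]] 3
        by simp
    next
      case 4
      then show ?thesis
        by (intro low_degree_ideal_high[of _ j] free_algebra_deg_diff arc_hom_deg elem_sym_deg) auto
    qed (simp_all add: elem_sym_walk[OF w(1,2), simplified] elem_sym_walk[OF w(3,4), simplified]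
        low_degree_ideal_zero)
  qed
  then show "arc_hom x \<in> (rel_ideal :: (_ \<Rightarrow>\<^sub>0 'k) set)"
    unfolding x arc_hom_simps by (intro low_degree_ideal_mult(1) reduced_rel_deg)
qed

abbreviation graph_coset ::
    "((H_vertex \<times> H_vertex) list \<Rightarrow>\<^sub>0 'k::field) \<Rightarrow> ((H_vertex \<times> H_vertex) list \<Rightarrow>\<^sub>0 'k) set" where
  "graph_coset p \<equiv> graph_ideal graph_H +>\<^bsub>free_algebra (arcs graph_H) :: ('k, _) module\<^esub> p"

definition representative ::
    "((H_vertex \<times> H_vertex) list \<Rightarrow>\<^sub>0 'k::field) set \<Rightarrow> (H_vertex \<times> H_vertex) list \<Rightarrow>\<^sub>0 'k" where
  "representative C = (SOME p. p \<in> free_algebra_deg (arcs graph_H) 1 \<and> C = graph_coset p)"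

lemma representative:
  assumes "C \<in> graph_algebra_deg graph_H 1"
  shows "representative C \<in> free_algebra_deg (arcs graph_H) 1" "graph_coset (representative C) = C"
proof -
  from assms obtain p where "p \<in> free_algebra_deg (arcs graph_H) 1 \<and> C = graph_coset p"
    unfolding graph_algebra_deg_def by blast
  from someI[of "\<lambda>p. p \<in> free_algebra_deg (arcs graph_H) 1 \<and> C = graph_coset p", OF this]
  show "representative C \<in> free_algebra_deg (arcs graph_H) 1" "graph_coset (representative C) = C"
    unfolding representative_def by simp_all
qed

definition degree_one_coord ::
    "((H_vertex \<times> H_vertex) list \<Rightarrow>\<^sub>0 'k::field) set \<Rightarrow> H_vertex list \<Rightarrow>\<^sub>0 'k" where
  "degree_one_coord C = arc_hom (representative C)"

text \<open>
  Different representatives have the same coordinates because the bounding ideal contains no linear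
  form but \<open>0\<close>.
\<close>

lemma degree_one_coord_coset:
  fixes p :: "_ \<Rightarrow>\<^sub>0 'k::field"
  assumes p: "p \<in> free_algebra_deg (arcs graph_H) 1"
  shows "degree_one_coord (graph_coset p) = arc_hom p"
proof -
  interpret I: algebra_ideal "free_algebra (arcs graph_H)" "graph_ideal graph_H :: (_ \<Rightarrow>\<^sub>0 'k) set"
    by (rule algebra_ideal_graph_ideal)
  let ?q = "representative (graph_coset p)"
  have "graph_coset p \<in> graph_algebra_deg graph_H 1"
    using p unfolding graph_algebra_deg_def by blast
  note q = representative[OF this]
  note c = subsetD[OF free_algebra_deg_subset]
  have "?q \<in> graph_coset p" using I.a_rcos_self[OF c[OF q(1)]] q(2) by simp
  then obtain h where "h \<in> graph_ideal graph_H" "?q = h + p" by (auto simp: a_r_coset_def')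
  then have "?q - p \<in> graph_ideal graph_H" by simp
  then have "arc_hom (?q - p) \<in> rel_ideal" by (rule arc_hom_graph_ideal)
  moreover have "arc_hom (?q - p) \<in> free_algebra_deg UNIV 1"
    by (rule arc_hom_deg[OF free_algebra_deg_diff[OF q(1) p]])
  ultimately have "arc_hom (?q - p) = 0"
    by (rule low_degree_ideal_linear) (rule reduced_rel_deg)
  then show ?thesis by (simp add: degree_one_coord_def)
qed

lemma algebra_coordinates_H:
  "algebra_coordinates (graph_algebra graph_H :: ('k::field, _) module) (graph_algebra_deg graph_H 1)
     degree_one_coord"
proof -
  interpret I: algebra_ideal "free_algebra (arcs graph_H)" "graph_ideal graph_H :: (_ \<Rightarrow>\<^sub>0 'k) set"
    by (rule algebra_ideal_graph_ideal)
  interpret S: algebra_subspace "graph_algebra graph_H :: ('k, _) module" "graph_algebra_deg graph_H 1"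
    by (rule graph_algebra_subspace)
  note c = subsetD[OF free_algebra_deg_subset]
  show ?thesis
  proof
    fix v w :: "(_ \<Rightarrow>\<^sub>0 'k) set" and k :: 'k
    assume v: "v \<in> graph_algebra_deg graph_H 1"
    show "degree_one_coord v \<in> free_algebra_deg UNIV 1"
      unfolding degree_one_coord_def by (rule arc_hom_deg[OF representative(1)[OF v]])
    from v obtain p where p: "v = graph_coset p" "p \<in> free_algebra_deg (arcs graph_H) 1"
      unfolding graph_algebra_deg_def by blast
    have "degree_one_coord (graph_coset (Poly_Mapping.single [] k * p)) =
        Poly_Mapping.single [] k * arc_hom p"
      using algebra_homD(5)[OF arc_hom_hom, of p k] p(2)
      by (simp add: degree_one_coord_coset[OF free_algebra_deg_scalar] del: One_nat_def arc_hom_simps)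
    then show "degree_one_coord (k \<odot>\<^bsub>graph_algebra graph_H\<^esub> v) = Poly_Mapping.single [] k * degree_one_coord v"
      unfolding graph_algebra_def p(1) I.quotient_smult[OF c[OF p(2)]] degree_one_coord_coset[OF p(2)]
        free_algebra_sel .
    assume "w \<in> graph_algebra_deg graph_H 1"
    then obtain q where q: "w = graph_coset q" "q \<in> free_algebra_deg (arcs graph_H) 1"
      unfolding graph_algebra_deg_def by blast
    have "degree_one_coord (graph_coset (p + q)) = arc_hom p + arc_hom q"
      using degree_one_coord_coset[OF free_algebra_deg_add[OF p(2) q(2)]] by simp
    then show "degree_one_coord (v \<oplus>\<^bsub>graph_algebra graph_H\<^esub> w) = degree_one_coord v + degree_one_coord w"
      unfolding graph_algebra_def p(1) q(1) I.quotient_ops(1)[OF c[OF p(2)] c[OF q(2)]]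
        degree_one_coord_coset[OF p(2)] degree_one_coord_coset[OF q(2)] free_algebra_sel .
  qed
qed

text \<open>
  Replacing each letter, an element of \<open>W\<close>, by a chosen combination of edges turns a relation \<open>r\<close> into an
  element of the graph ideal, to which \<open>arc_hom_graph_ideal\<close> applies.
\<close>

lemma quadratic_relation_in_rel:
  fixes r :: "(_ \<Rightarrow>\<^sub>0 'k::field) set list \<Rightarrow>\<^sub>0 'k"
  assumes r: "r \<in> free_algebra_deg (graph_algebra_deg graph_H 1) 2"
    and zero: "free_eval (graph_algebra graph_H) r = \<zero>\<^bsub>graph_algebra graph_H\<^esub>"
  shows "poly_value (free_algebra UNIV) degree_one_coord r \<in> rel_ideal"
proof -
  let ?W = "graph_algebra_deg graph_H 1 :: (_ \<Rightarrow>\<^sub>0 'k) set set"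
  let ?E = "free_algebra (arcs graph_H) :: ('k, _) module"
  interpret I: algebra_ideal ?E "graph_ideal graph_H :: (_ \<Rightarrow>\<^sub>0 'k) set"
    by (rule algebra_ideal_graph_ideal)
  interpret S: algebra_subspace "graph_algebra graph_H :: ('k, _) module" ?W
    by (rule graph_algebra_subspace)
  note c = subsetD[OF free_algebra_deg_subset]
  have r': "r \<in> carrier (free_algebra ?W)" by (rule c[OF r])
  have rep: "representative \<in> ?W \<rightarrow> carrier ?E"
    using representative(1) c by blast
  define q where "q = poly_value ?E representative r"
  have q: "q \<in> carrier ?E"
    unfolding q_def by (rule I.poly_value_closed[OF rep r'])
  have "graph_coset q = poly_value (graph_algebra graph_H) (graph_coset \<circ> representative) r"
    unfolding q_def graph_algebra_def
    by (rule algebra_hom_poly_value[OF I.assoc_algebra_axioms I.assoc_algebra_quotient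
          I.coset_algebra_hom rep r'])
  also have "\<dots> = poly_value (graph_algebra graph_H) (\<lambda>C. C) r"
    by (rule poly_value_cong[OF S.assoc_algebra_axioms _ r', symmetric])
      (use S.W_subset representative(2) in auto)
  also have "\<dots> = graph_ideal graph_H"
    using zero by (simp add: free_eval_eq_poly_value graph_algebra_def)
  finally have "q \<in> graph_ideal graph_H"
    using I.a_rcos_self[OF q] by simp
  then have "arc_hom q \<in> rel_ideal" by (rule arc_hom_graph_ideal)
  moreover have "arc_hom \<in> algebra_hom ?E (free_algebra UNIV)"
    unfolding arc_hom_def
    by (rule assoc_algebra.poly_value_algebra_hom[OF assoc_algebra_free]) auto
  then have "arc_hom q = poly_value (free_algebra UNIV) (arc_hom \<circ> representative) r"
    unfolding q_def
    by (intro algebra_hom_poly_value[OF assoc_algebra_free assoc_algebra_free _ rep r'])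
  ultimately show ?thesis by (simp add: degree_one_coord_def[abs_def] comp_def)
qed

section \<open>The relations of \<open>H\<close> do not overlap\<close>

lemma lookup_coord:
  "Poly_Mapping.lookup (coord u * p) (v # w) =
    (if u = v \<and> u \<noteq> v_star \<and> u \<noteq> v_p then Poly_Mapping.lookup p w else 0)"
  "Poly_Mapping.lookup (coord u) (v # w) = (if u = v \<and> u \<noteq> v_star \<and> u \<noteq> v_p \<and> w = [] then 1 else 0)"
  by (auto simp: coord_def lookup_letter)

lemmas lookup_reduced_rel = reduced_rel_def left_diff_distrib distrib_right lookup_add lookup_minus lookup_coord

text \<open>
  The images of \<open>R \<otimes> W\<close> and \<open>W \<otimes> R\<close> meet only in \<open>0\<close>. If the two expansions agree, the coefficients
  are eliminated in the order of the levels of the first letter. On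
  leading parts the reason is this. An element of the intersection with first letter \<open>u\<close> has the form
  \<open>u (v - v') c\<close> with \<open>(v - v') c\<close> a relation. For \<open>u \<noteq> a\<close> one of \<open>v\<close>, \<open>v'\<close> is \<open>w\<^sub>1\<close> or \<open>q\<close>, which
  begins no leading part. For \<open>u = a\<close> the factor \<open>c\<close> would have to be a multiple both of
  \<open>w\<^sub>1 - w\<^sub>2\<close> and of \<open>w\<^sub>1 - w\<^sub>3\<close>.
\<close>

lemma relations_do_not_overlap:
  fixes b c :: "H_vertex \<Rightarrow> H_vertex \<Rightarrow> 'k::field"
  assumes "\<And>i j k. (\<Sum>v\<in>rel_vertices. c v k * Poly_Mapping.lookup (reduced_rel v) [i, j]) =
      (\<Sum>v\<in>rel_vertices. b v i * Poly_Mapping.lookup (reduced_rel v) [j, k])"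
    and "v \<in> rel_vertices"
  shows "c v k = 0"
proof -
  note eq = assms(1)[unfolded rel_vertices_def, simplified]
  have a: "c v_a k = 0" for k
  proof -
    have "b v_a v_a = 0" using eq[of v_x v_a v_a] by (simp add: lookup_reduced_rel)
    moreover have "b v_x v_a = 0"
      using eq[of v_w2 v_a v_x] eq[of v_w2 v_a v_y] by (simp add: lookup_reduced_rel)
    ultimately show ?thesis using eq[of k v_a v_x] by (simp add: lookup_reduced_rel)
  qed
  have x: "c v_x k = 0" for k
  proof -
    have "b v_x v_x = 0" using eq[of v_w2 v_x v_x] a by (simp add: lookup_reduced_rel)
    moreover have "b v_y v_x = 0" using eq[of v_w3 v_x v_y] a by (simp add: lookup_reduced_rel)
    ultimately show ?thesis using eq[of k v_x v_w1] a by (simp add: lookup_reduced_rel)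
  qed
  have y: "c v_y k = 0" for k
  proof -
    have "b v_x v_y = 0" using eq[of v_w2 v_y v_x] a by (simp add: lookup_reduced_rel)
    moreover have "b v_y v_y = 0" using eq[of v_w3 v_y v_y] a by (simp add: lookup_reduced_rel)
    ultimately show ?thesis using eq[of k v_y v_w1] a by (simp add: lookup_reduced_rel)
  qed
  have w: "c v_w2 k = 0" "c v_w3 k = 0" for k
  proof -
    have "b v_w2 u = 0" "b v_w3 u = 0" if "u = v_w2 \<or> u = v_w3" for u
      using eq[of v_q u v_w2] eq[of v_q u v_w3] x y that by (auto simp: lookup_reduced_rel)
    then show "c v_w2 k = 0" "c v_w3 k = 0"
      using eq[of k v_w2 v_q] eq[of k v_w3 v_q] by (simp_all add: lookup_reduced_rel)
  qed
  show ?thesis using assms(2) a x y w by (auto simp: rel_vertices_def)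
qed

section \<open>The exact overlap identity\<close>

text \<open>
  The element of \<open>Y \<inter> (X + Z)\<close>, for \<open>X = R \<otimes> W \<otimes> W\<close>, \<open>Y = W \<otimes> R \<otimes> W\<close>, \<open>Z = W \<otimes> W \<otimes> R\<close>. On the left each relation stands between two factors, in
  the first bracket on the right it comes first, in the second one last. The identity is obtained
  from the leading part \<open>a (rx - ry) (p - q)\<close> by rewriting with the relations, starting at the right
  end, until only multiples of \<open>ra\<close> and corrections of lower level are left; it is an identity between
  noncommutative polynomials.
\<close>

lemma overlap_identity:
  fixes a x y w1 w2 w3 p q :: "'r::ring"
  defines "ra \<equiv> (a - x) * (x - w1) - (a - y) * (y - w1)"
    and "rx \<equiv> (x - w1) * (w1 - p) - (x - w2) * (w2 - p)"
    and "ry \<equiv> (y - w1) * (w1 - p) - (y - w3) * (w3 - p)"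
    and "r2 \<equiv> (w2 - p) * p - (w2 - q) * q"
    and "r3 \<equiv> (w3 - p) * p - (w3 - q) * q"
  shows "(a - x) * rx * (p - q) + (y - a) * ry * (p - q) + (w2 - a) * r2 * q + (a - w3) * r3 * q =
    (ra * (w1 * (p - q) - (p * p - q * q)) + rx * ((p - q) * q) + ry * ((q - p) * q)
      + r3 * (q * q) - r2 * (q * q)) +
    ((x - a) * (x - w2) * r2 + (a - y) * (y - w3) * r3)"
  unfolding assms by (simp add: algebra_simps)


section \<open>Vertices as elements of degree one\<close>

text \<open>
  A chosen path from each vertex to \<open>*\<close>; only its sum of edges in \<open>A(H)\<close> matters, and this does
  not depend on the choice.
\<close>

definition descent :: "H_vertex \<Rightarrow> (H_vertex \<times> H_vertex) list" where
  "descent v = (case v of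
      v_star \<Rightarrow> []
    | v_p \<Rightarrow> [(v_p, v_star)]
    | v_q \<Rightarrow> [(v_q, v_star)]
    | v_w1 \<Rightarrow> [(v_w1, v_p), (v_p, v_star)]
    | v_w2 \<Rightarrow> [(v_w2, v_p), (v_p, v_star)]
    | v_w3 \<Rightarrow> [(v_w3, v_p), (v_p, v_star)]
    | v_x \<Rightarrow> [(v_x, v_w1), (v_w1, v_p), (v_p, v_star)]
    | v_y \<Rightarrow> [(v_y, v_w1), (v_w1, v_p), (v_p, v_star)]
    | v_a \<Rightarrow> [(v_a, v_x), (v_x, v_w1), (v_w1, v_p), (v_p, v_star)])"

lemma awalk_descent: "pre_digraph.awalk graph_H v (descent v) v_star"
  by (cases v) (simp_all add: descent_def pre_digraph.awalk_def pre_digraph.cas.simps graph_H_def)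

abbreviation vertex_sum :: "H_vertex \<Rightarrow> (H_vertex \<times> H_vertex) list \<Rightarrow>\<^sub>0 'k::field" where
  "vertex_sum v \<equiv> elem_sym 1 (descent v)"

lemma vertex_sum_deg: "vertex_sum v \<in> free_algebra_deg (arcs graph_H) 1"
  by (rule elem_sym_deg) (use awalk_descent[of v] in \<open>simp add: pre_digraph.awalk_def\<close>)

lemma arc_hom_vertex_sum: "arc_hom (vertex_sum v) = coord v"
proof -
  have "pre_digraph.cas graph_H v (descent v) v_star" "set (descent v) \<subseteq> arcs graph_H"
    using awalk_descent[of v] by (simp_all add: pre_digraph.awalk_def)
  from conjunct1[OF elem_sym_walk[OF this]] show ?thesis by (simp add: coord_def)
qed

lemma letter_arc_in_graph_ideal:
  assumes uv: "(u, v) \<in> arcs graph_H"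
  shows "(vertex_sum u - vertex_sum v) - letter (u, v) \<in> (graph_ideal graph_H :: (_ \<Rightarrow>\<^sub>0 'k::field) set)"
proof -
  have len: "length (descent u) = length ((u, v) # descent v)"
    using uv by (auto simp: graph_H_def descent_def)
  have walk: "pre_digraph.awalk graph_H u ((u, v) # descent v) v_star"
    using uv awalk_descent[of v] awalk_descent[of u]
    by (simp add: pre_digraph.awalk_def pre_digraph.cas.simps) (simp add: graph_H_def)
  have "vertex_sum u - elem_sym 1 ((u, v) # descent v) \<in> (graph_ideal graph_H :: (_ \<Rightarrow>\<^sub>0 'k) set)"
    using len by (intro elem_sym_diff_in_graph_ideal[OF len awalk_descent walk]) simp
  then show ?thesis by (simp add: algebra_simps)
qed

lemma arc_product_in_graph_ideal:
  assumes "(u, v) \<in> arcs graph_H" "(v, z) \<in> arcs graph_H" "(u, v') \<in> arcs graph_H" "(v', z) \<in> arcs graph_H"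
  shows "letter (u, v) * letter (v, z) - letter (u, v') * letter (v', z)
    \<in> (graph_ideal graph_H :: (_ \<Rightarrow>\<^sub>0 'k::field) set)"
proof -
  have walk: "pre_digraph.awalk graph_H u [(u, v), (v, z)] z" if "(u, v) \<in> arcs graph_H" "(v, z) \<in> arcs graph_H"
    for v
    using that wf_digraph.tail_in_verts[OF layered_graph.axioms(1)[OF layered_graph_H] that(1)]
    by (simp add: pre_digraph.awalk_def pre_digraph.cas.simps) (simp add: graph_H_def)
  have "elem_sym 2 [(u, v), (v, z)] - elem_sym 2 [(u, v'), (v', z)] \<in> (graph_ideal graph_H :: (_ \<Rightarrow>\<^sub>0 'k) set)"
    by (rule elem_sym_diff_in_graph_ideal[OF _ walk walk]) (use assms in auto)
  then show ?thesis by (simp add: numeral_2_eq_2)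
qed

definition vertex_class :: "H_vertex \<Rightarrow> ((H_vertex \<times> H_vertex) list \<Rightarrow>\<^sub>0 'k::field) set" where
  "vertex_class v = graph_coset (vertex_sum v)"

lemma vertex_class_degree: "vertex_class v \<in> graph_algebra_deg graph_H 1"
  unfolding vertex_class_def graph_algebra_deg_def using vertex_sum_deg by blast

text \<open>
  The class of \<open>*\<close> is \<open>0\<close> in \<open>A(H)\<close>, but as a letter of the free algebra on \<open>W\<close> it is not \<open>0\<close>.
  Subtracting it makes \<open>*\<close> vanish already there and does not affect differences of vertices.
\<close>

definition vertex_form :: "H_vertex \<Rightarrow> ((H_vertex \<times> H_vertex) list \<Rightarrow>\<^sub>0 'k::field) set list \<Rightarrow>\<^sub>0 'k" where
  "vertex_form v = letter (vertex_class v) - letter (vertex_class v_star)"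

lemma vertex_form_star: "vertex_form v_star = 0"
  by (simp add: vertex_form_def)

lemma vertex_form_deg: "vertex_form v \<in> free_algebra_deg (graph_algebra_deg graph_H 1) 1"
  unfolding vertex_form_def
  by (intro free_algebra_deg_diff free_algebra_deg_letter vertex_class_degree)

definition path_relator ::
    "H_vertex \<Rightarrow> H_vertex \<Rightarrow> H_vertex \<Rightarrow> H_vertex \<Rightarrow> ((H_vertex \<times> H_vertex) list \<Rightarrow>\<^sub>0 'k::field) set list \<Rightarrow>\<^sub>0 'k"
  where
  "path_relator u v v' z = (vertex_form u - vertex_form v) * (vertex_form v - vertex_form z)
     - (vertex_form u - vertex_form v') * (vertex_form v' - vertex_form z)"

lemma path_relator_deg: "path_relator u v v' z \<in> free_algebra_deg (graph_algebra_deg graph_H 1) 2"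
  unfolding path_relator_def one_add_one[symmetric]
  by (intro free_algebra_deg_diff free_algebra_deg_mult vertex_form_deg)

lemma free_eval_path_relator:
  assumes arcs: "(u, v) \<in> arcs graph_H" "(v, z) \<in> arcs graph_H" "(u, v') \<in> arcs graph_H" "(v', z) \<in> arcs graph_H"
  shows "free_eval (graph_algebra graph_H :: ('k::field, _) module) (path_relator u v v' z) =
    \<zero>\<^bsub>graph_algebra graph_H :: ('k, _) module\<^esub>"
proof -
  let ?A = "graph_algebra graph_H :: ('k, _) module"
  let ?W = "graph_algebra_deg graph_H 1 :: (_ \<Rightarrow>\<^sub>0 'k) set set"
  let ?E = "free_algebra (arcs graph_H) :: ('k, _) module"
  interpret I: algebra_ideal ?E "graph_ideal graph_H :: (_ \<Rightarrow>\<^sub>0 'k) set"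
    by (rule algebra_ideal_graph_ideal)
  interpret S: algebra_subspace ?A ?W
    by (rule graph_algebra_subspace)
  note cW = subsetD[OF free_algebra_deg_subset[of ?W]]
  note cE = subsetD[OF free_algebra_deg_subset[of "arcs graph_H"]]
  have fe: "free_eval ?A \<in> algebra_hom (free_algebra ?W) ?A"
    unfolding free_eval_eq_poly_value using S.W_subset by (intro S.poly_value_algebra_hom) auto
  have co: "graph_coset \<in> algebra_hom ?E ?A"
    unfolding graph_algebra_def by (rule I.coset_algebra_hom)
  note fe_diff = algebra_hom_free_diff[OF S.assoc_algebra_axioms fe]
  note co_diff = algebra_hom_free_diff[OF S.assoc_algebra_axioms co]
  note fe_mult = algebra_homD(3)[OF fe, unfolded free_algebra_sel(2)]
  note co_mult = algebra_homD(3)[OF co, unfolded free_algebra_sel(2)]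
  have sum: "free_eval ?A (letter (vertex_class t)) = graph_coset (vertex_sum t)" for t
    unfolding free_eval_eq_poly_value
    using S.poly_value_letter[of "\<lambda>x. x" "vertex_class t"] subsetD[OF S.W_subset vertex_class_degree]
    by (simp add: vertex_class_def)
  have form: "free_eval ?A (vertex_form t) = graph_coset (vertex_sum t - vertex_sum v_star)" for t
    unfolding vertex_form_def
    by (simp only: fe_diff co_diff sum cW[OF free_algebra_deg_letter] vertex_class_degree
        cE[OF vertex_sum_deg])
  have edge: "free_eval ?A (vertex_form s - vertex_form t) = graph_coset (letter (s, t))"
    if st: "(s, t) \<in> arcs graph_H" for s t
  proof -
    have "free_eval ?A (vertex_form s - vertex_form t) =
        graph_coset ((vertex_sum s - vertex_sum v_star) - (vertex_sum t - vertex_sum v_star))"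
      by (simp only: fe_diff[OF cW[OF vertex_form_deg] cW[OF vertex_form_deg]] form
          co_diff[OF cE[OF free_algebra_deg_diff[OF vertex_sum_deg vertex_sum_deg]]
            cE[OF free_algebra_deg_diff[OF vertex_sum_deg vertex_sum_deg]]])
    also have "\<dots> = graph_coset (vertex_sum s - vertex_sum t)" by simp
    also have "\<dots> = graph_coset (((vertex_sum s - vertex_sum t) - letter (s, t)) + letter (s, t))" by simp
    also have "\<dots> = graph_coset (letter (s, t))"
    proof -
      have l: "letter (s, t) \<in> carrier ?E" by (rule cE[OF free_algebra_deg_letter[OF st]])
      have "graph_coset ((vertex_sum s - vertex_sum t) - letter (s, t)) = (graph_ideal graph_H :: (_ \<Rightarrow>\<^sub>0 'k) set)"
        by (rule I.a_rcos_const[OF letter_arc_in_graph_ideal[OF st]])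
      then show ?thesis
        using algebra_homD(2)[OF co I.Icarr[OF letter_arc_in_graph_ideal[OF st]] l]
          S.l_zero[OF algebra_homD(1)[OF co l]]
        by (simp add: graph_algebra_def del: quotient_algebra_sel(1,2,3,5,6))
    qed
    finally show ?thesis .
  qed
  note d = free_algebra_deg_diff[OF vertex_form_deg vertex_form_deg]
  have prod: "free_eval ?A ((vertex_form s - vertex_form t) * (vertex_form t - vertex_form z)) =
      graph_coset (letter (s, t) * letter (t, z))"
    if "(s, t) \<in> arcs graph_H" "(t, z) \<in> arcs graph_H" for s t
    using that
    by (simp only: fe_mult[OF cW[OF d] cW[OF d]] edge
        co_mult[OF cE[OF free_algebra_deg_letter] cE[OF free_algebra_deg_letter]])
  have lprod: "letter (s, t) * letter (t, z) \<in> carrier ?E"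
    if "(s, t) \<in> arcs graph_H" "(t, z) \<in> arcs graph_H" for s t
    by (rule cE[OF free_algebra_deg_mult[OF free_algebra_deg_letter[OF that(1)] free_algebra_deg_letter[OF that(2)]]])
  have "free_eval ?A (path_relator u v v' z) =
      graph_coset (letter (u, v) * letter (v, z) - letter (u, v') * letter (v', z))"
    unfolding path_relator_def
    using arcs
    by (simp only: fe_diff[OF cW[OF free_algebra_deg_mult[OF d d]] cW[OF free_algebra_deg_mult[OF d d]]]
       prod co_diff[OF lprod lprod])
  also have "\<dots> = graph_ideal graph_H"
    by (rule I.a_rcos_const[OF arc_product_in_graph_ideal[OF arcs]])
  finally show ?thesis by (simp add: graph_algebra_def)
qed


section \<open>Failure of distributivity\<close>

lemma middle_relation_coefficients:
  assumes "has_relation_at reduced_rel rel_vertices 1 1 q"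
  obtains b where "\<And>i j k l. Poly_Mapping.lookup q [i, j, k, l] =
    (\<Sum>v\<in>rel_vertices. b v i l * Poly_Mapping.lookup (reduced_rel v) [j, k])"
proof -
  from assms obtain c where c: "\<And>w. length w = 4 \<Longrightarrow> Poly_Mapping.lookup q w =
       (\<Sum>v\<in>rel_vertices. c v (take 1 w) (drop 3 w) * Poly_Mapping.lookup (reduced_rel v) (take 2 (drop 1 w)))"
    unfolding has_relation_at_def by (auto simp: numeral_eq_Suc)
  show ?thesis
    by (rule that[of "\<lambda>v i l. c v [i] [l]"]) (simp add: c numeral_2_eq_2)
qed

text \<open>
  \<open>Y \<inter> X = 0\<close> in coordinates: with the last letter fixed, this is an overlap in degree 3.
\<close>

lemma no_left_middle_overlap:
  assumes "has_relation_at reduced_rel rel_vertices 0 2 q" "has_relation_at reduced_rel rel_vertices 1 1 q"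
  shows "Poly_Mapping.lookup q [i, j, k, l] = 0"
proof -
  from assms(1) obtain c where c: "\<And>w. length w = 4 \<Longrightarrow> Poly_Mapping.lookup q w =
       (\<Sum>v\<in>rel_vertices. c v (take 0 w) (drop 2 w) * Poly_Mapping.lookup (reduced_rel v) (take 2 (drop 0 w)))"
    unfolding has_relation_at_def by (auto simp: numeral_eq_Suc)
  obtain b where b: "\<And>i j k l. Poly_Mapping.lookup q [i, j, k, l] =
    (\<Sum>v\<in>rel_vertices. b v i l * Poly_Mapping.lookup (reduced_rel v) [j, k])"
    using middle_relation_coefficients[OF assms(2)] by blast
  have lookup: "Poly_Mapping.lookup q [i, j, k, l] =
    (\<Sum>v\<in>rel_vertices. c v [] [k, l] * Poly_Mapping.lookup (reduced_rel v) [i, j])" for i j k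
    by (simp add: c numeral_2_eq_2)
  have "c v [] [k, l] = 0" if "v \<in> rel_vertices" for v
    by (rule relations_do_not_overlap[where c = "\<lambda>v k. c v [] [k, l]" and b = "\<lambda>v i. b v i l", OF _ that])
      (simp only: lookup[symmetric] b)
  then show ?thesis by (simp add: lookup)
qed

text \<open>
  \<open>Y \<inter> Z = 0\<close> in coordinates: with the first letter fixed, this is an overlap in degree 3.
\<close>

lemma no_middle_right_overlap:
  assumes "has_relation_at reduced_rel rel_vertices 1 1 q" "has_relation_at reduced_rel rel_vertices 2 0 q"
  shows "Poly_Mapping.lookup q [i, j, k, l] = 0"
proof -
  from assms(2) obtain c where c: "\<And>w. length w = 4 \<Longrightarrow> Poly_Mapping.lookup q w =
       (\<Sum>v\<in>rel_vertices. c v (take 2 w) (drop 4 w) * Poly_Mapping.lookup (reduced_rel v) (take 2 (drop 2 w)))"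
    unfolding has_relation_at_def by (auto simp: numeral_eq_Suc)
  obtain b where b: "\<And>i j k l. Poly_Mapping.lookup q [i, j, k, l] =
    (\<Sum>v\<in>rel_vertices. b v i l * Poly_Mapping.lookup (reduced_rel v) [j, k])"
    using middle_relation_coefficients[OF assms(1)] by blast
  have lookup: "Poly_Mapping.lookup q [i, j, k, l] =
    (\<Sum>v\<in>rel_vertices. c v [i, j] [] * Poly_Mapping.lookup (reduced_rel v) [k, l])" for j k l
    by (simp add: c numeral_2_eq_2)
  have "b v i l = 0" if "v \<in> rel_vertices" for v
    by (rule relations_do_not_overlap[where c = "\<lambda>v l. b v i l" and b = "\<lambda>v j. c v [i, j] []", OF _ that])
      (simp only: lookup[symmetric] b)
  then show ?thesis by (simp add: b)
qed

theorem theorem3p1: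
  shows "\<not> koszul (graph_algebra graph_H :: ('k::field, _) module) (graph_algebra_deg graph_H 1)"
proof
  let ?A = "graph_algebra graph_H :: ('k, _) module"
  let ?W = "graph_algebra_deg graph_H 1 :: (_ \<Rightarrow>\<^sub>0 'k) set set"
  interpret algebra_coordinates ?A ?W degree_one_coord
    by (rule algebra_coordinates_H)
  assume koszul: "koszul ?A ?W"
  define X where "X = relation_subspace ?A ?W 0 2"
  define Y where "Y = relation_subspace ?A ?W 1 1"
  define Z where "Z = relation_subspace ?A ?W 2 0"
  let ?S = "{relation_subspace ?A ?W i (4 - i - 2) | i. i \<le> 4 - 2}"
  have in_lattice: "X \<in> generated_lattice T ?S" "Y \<in> generated_lattice T ?S" "Z \<in> generated_lattice T ?S"
    unfolding X_def Y_def Z_def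
    by (rule generated_lattice.incl, force intro: exI[of _ 0] exI[of _ 1] exI[of _ 2])+
  have "generates_distributive_lattice T ?S"
    using koszul[unfolded koszul_def, rule_format, of 4] by simp
  then have distrib: "Y \<inter> (X <+>\<^bsub>T\<^esub> Z) = (Y \<inter> X) <+>\<^bsub>T\<^esub> (Y \<inter> Z)"
    using in_lattice unfolding generates_distributive_lattice_def by blast

  have \<Psi>_rel: "has_relation_at reduced_rel rel_vertices i j (\<Psi> C)" if "C \<in> relation_subspace ?A ?W i j" for C i j
  proof (rule \<Psi>_relation_subspace[OF _ that])
    fix r assume "r \<in> free_algebra_deg ?W 2" "free_eval ?A r = \<zero>\<^bsub>?A\<^esub>"
    then have "\<psi> r \<in> rel_ideal"
      unfolding \<psi>_def by (rule quadratic_relation_in_rel)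
    then show "\<exists>c. \<forall>w. length w = 2 \<longrightarrow> Poly_Mapping.lookup (\<psi> r) w =
        (\<Sum>v\<in>rel_vertices. c v * Poly_Mapping.lookup (reduced_rel v) w)"
      unfolding low_degree_ideal_def by auto
  qed

  define f where "f = (vertex_form :: H_vertex \<Rightarrow> (_ \<Rightarrow>\<^sub>0 'k) set list \<Rightarrow>\<^sub>0 'k)"
  define ra where "ra = (path_relator v_a v_x v_y v_w1 :: (_ \<Rightarrow>\<^sub>0 'k) set list \<Rightarrow>\<^sub>0 'k)"
  define rx where "rx = (path_relator v_x v_w1 v_w2 v_p :: (_ \<Rightarrow>\<^sub>0 'k) set list \<Rightarrow>\<^sub>0 'k)"
  define ry where "ry = (path_relator v_y v_w1 v_w3 v_p :: (_ \<Rightarrow>\<^sub>0 'k) set list \<Rightarrow>\<^sub>0 'k)"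
  define r2 where "r2 = (path_relator v_w2 v_p v_q v_star :: (_ \<Rightarrow>\<^sub>0 'k) set list \<Rightarrow>\<^sub>0 'k)"
  define r3 where "r3 = (path_relator v_w3 v_p v_q v_star :: (_ \<Rightarrow>\<^sub>0 'k) set list \<Rightarrow>\<^sub>0 'k)"
  have r_deg: "r \<in> free_algebra_deg ?W 2" "free_eval ?A r = \<zero>\<^bsub>?A\<^esub>" if "r \<in> {ra, rx, ry, r2, r3}" for r
  proof -
    show "r \<in> free_algebra_deg ?W 2"
      using that path_relator_deg by (auto simp: ra_def rx_def ry_def r2_def r3_def)
    have "free_eval ?A r = \<zero>\<^bsub>?A\<^esub>" if "r = path_relator u v v' z" "(u, v) \<in> arcs graph_H" "(v, z) \<in> arcs graph_H"
      "(u, v') \<in> arcs graph_H" "(v', z) \<in> arcs graph_H" for u v v' z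
      unfolding that(1) by (rule free_eval_path_relator[OF that(2-5)])
    then show "free_eval ?A r = \<zero>\<^bsub>?A\<^esub>"
      using that unfolding ra_def rx_def ry_def r2_def r3_def by (auto simp: graph_H_def)
  qed
  have f_deg: "f v \<in> free_algebra_deg ?W 1" for v
    unfolding f_def by (rule vertex_form_deg)
  have fd: "f u - f v \<in> free_algebra_deg ?W 1" for u v
    by (intro free_algebra_deg_diff f_deg)
  have ff: "p * q \<in> free_algebra_deg ?W 2" if "p \<in> free_algebra_deg ?W 1" "q \<in> free_algebra_deg ?W 1" for p q
    using free_algebra_deg_mult[OF that] by (simp add: numeral_2_eq_2)

  \<comment> \<open>The two sides of \<open>overlap_identity\<close>, as sums of products with a relation in the prescribed place.\<close>
  define yy where "yy = (f v_a - f v_x) * rx * (f v_p - f v_q) + (f v_y - f v_a) * ry * (f v_p - f v_q)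
    + (f v_w2 - f v_a) * r2 * f v_q + (f v_a - f v_w3) * r3 * f v_q"
  define xx where "xx = 1 * ra * (f v_w1 * (f v_p - f v_q) - (f v_p * f v_p - f v_q * f v_q))
    + 1 * rx * ((f v_p - f v_q) * f v_q) + 1 * ry * ((f v_q - f v_p) * f v_q)
    + 1 * r3 * (f v_q * f v_q) + 1 * r2 * (0 - f v_q * f v_q)"
  define zz where "zz = ((f v_x - f v_a) * (f v_x - f v_w2)) * r2 * 1 + ((f v_a - f v_y) * (f v_y - f v_w3)) * r3 * 1"
  have split: "yy = xx + zz"
    using overlap_identity[where a = "f v_a" and x = "f v_x" and y = "f v_y" and ?w1.0 = "f v_w1"
        and ?w2.0 = "f v_w2" and ?w3.0 = "f v_w3" and p = "f v_p" and q = "f v_q"]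
    unfolding yy_def xx_def zz_def ra_def rx_def ry_def r2_def r3_def path_relator_def f_def
    by (simp add: vertex_form_star)

  \<comment> \<open>Homogeneous representatives of the elements of \<open>W\<^sup>i \<otimes> R \<otimes> W\<^sup>j\<close>.\<close>
  define U where "U i j = {p \<in> free_algebra_deg ?W (i + 2 + j). L +>\<^bsub>F\<^esub> p \<in> relation_subspace ?A ?W i j}" for i j
  have U_prod: "u * r * v \<in> U i j"
    if "u \<in> free_algebra_deg ?W i" "r \<in> {ra, rx, ry, r2, r3}" "v \<in> free_algebra_deg ?W j" for u r v i j
    unfolding U_def
    using relation_subspace_product[OF that(1) r_deg[OF that(2)] that(3)]
      free_algebra_deg_mult[OF free_algebra_deg_mult[OF that(1) r_deg(1)[OF that(2)]] that(3)] by blast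
  have U_add: "p + q \<in> U i j" if "p \<in> U i j" "q \<in> U i j" for p q i j
    using that relation_subspace_add[of p q i j] free_algebra_deg_add subsetD[OF free_algebra_deg_subset]
    unfolding U_def by blast
  have yU: "yy \<in> U 1 1"
    unfolding yy_def by (intro U_add U_prod fd f_deg) simp_all
  have xU: "xx \<in> U 0 2"
    unfolding xx_def
    by (intro U_add U_prod free_algebra_deg_one free_algebra_deg_diff ff fd f_deg free_algebra_deg_zero) simp_all
  have zU: "zz \<in> U 2 0"
    unfolding zz_def by (intro U_add U_prod free_algebra_deg_one ff fd f_deg) simp_all
  have carr: "p \<in> carrier F" if "p \<in> U i j" for p i j
    using that subsetD[OF free_algebra_deg_subset] unfolding U_def by blast
  have "L +>\<^bsub>F\<^esub> yy = (L +>\<^bsub>F\<^esub> xx) \<oplus>\<^bsub>T\<^esub> (L +>\<^bsub>F\<^esub> zz)"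
    using algebra_homD(2)[OF L.coset_algebra_hom carr[OF xU] carr[OF zU]]
    unfolding split T_eq free_algebra_sel(5) .
  then have "L +>\<^bsub>F\<^esub> yy \<in> Y \<inter> (X <+>\<^bsub>T\<^esub> Z)"
    using xU yU zU unfolding U_def X_def Y_def Z_def set_add_def' by blast
  then obtain C1 C2 where C: "C1 \<in> Y" "C1 \<in> X" "C2 \<in> Y" "C2 \<in> Z" "L +>\<^bsub>F\<^esub> yy = C1 \<oplus>\<^bsub>T\<^esub> C2"
    unfolding distrib unfolding set_add_def' by blast
  have "C1 \<in> carrier T" "C2 \<in> carrier T"
    using C relation_subspace_carrier unfolding Y_def by blast+
  then have "\<psi> yy = \<Psi> C1 + \<Psi> C2"
    using algebra_homD(2)[OF \<Psi>_hom] C(5) \<Psi>_coset[OF carr[OF yU]] by simp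
  then have zero: "Poly_Mapping.lookup (\<psi> yy) [v_a, v_x, v_w1, v_q] = 0"
    using no_left_middle_overlap[of "\<Psi> C1"] no_middle_right_overlap[of "\<Psi> C2"] \<Psi>_rel C
    unfolding X_def Y_def Z_def by (simp add: lookup_add)

  have psi_f: "\<psi> (f v) = coord v" for v
  proof -
    have l: "letter (vertex_class v) \<in> carrier F" for v
      by (rule subsetD[OF free_algebra_deg_subset free_algebra_deg_letter[OF vertex_class_degree]])
    have "degree_one_coord (vertex_class v) = (coord v :: _ \<Rightarrow>\<^sub>0 'k)" for v
      unfolding vertex_class_def degree_one_coord_coset[OF vertex_sum_deg] by (rule arc_hom_vertex_sum)
    then show ?thesis
      unfolding f_def vertex_form_def \<psi>_ops(3)[OF l l] \<psi>_letter by (simp add: coord_def)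
  qed
  have f_car: "f v \<in> carrier F" for v
    by (rule subsetD[OF free_algebra_deg_subset f_deg])
  have "\<psi> yy =
      (coord v_a - coord v_x) * reduced_rel v_x * (coord v_p - coord v_q)
      + (coord v_y - coord v_a) * reduced_rel v_y * (coord v_p - coord v_q)
      + (coord v_w2 - coord v_a) * (- reduced_rel v_w2) * coord v_q
      + (coord v_a - coord v_w3) * (- reduced_rel v_w3) * coord v_q"
    unfolding yy_def rx_def ry_def r2_def r3_def path_relator_def f_def[symmetric]
    by (simp only: \<psi>_ops free_algebra_closed f_car psi_f) (simp add: reduced_rel_def coord_def)
  \<comment> \<open>With \<open>p = 0\<close> the factor \<open>p - q\<close> becomes \<open>- q\<close>, hence the sign.\<close>
  then have "Poly_Mapping.lookup (\<psi> yy) [v_a, v_x, v_w1, v_q] = -1"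
    by (simp add: lookup_reduced_rel mult.assoc)
  with zero show False by simp
qed

end
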